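(* Let $s,t>0$ be real numbers and let $G=(V,E)$ be a finite simple graph with $V\neq\emptyset$ such that $\|V\|\ge (s+t+1)|V|$. Then there exists a non-trivial partition $(A,B)$ of $V$ (that is, $A\cup B=V$, $A\cap B=\emptyset$, $A\ne\emptyset$, $B\neq\emptyset$) such that (i) $\|A\|-s|A|\ge 0$; and (ii) $\|B\|-t|B|\ge 0$.
   Context: For a graph $G=(V,E)$ and a subset $X\subseteq V$, $|X|$ denotes the number of vertices in $X$ and $\|X\|$ denotes the number of edges of the induced subgraph $G[X]$; in particular $\|V\|=|E|$. Graphs are finite, simple (no loops, no multiple edges) and undirected. A partition $(A,B)$ of $V$ is non-trivial if both parts are non-empty. *)

theory Defs
  imports Complex_Main
begin

text \<open>Edges are two-element sets of vertices, so that each undirected edge is counted once;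
  this also excludes loops and multiple edges.\<close>

locale finite_simple_graph =
  fixes V :: "'a set" and E :: "'a set set"
  assumes finite_V: "finite V"
    and edge_subset: "e \<in> E \<Longrightarrow> e \<subseteq> V"
    and edge_card: "e \<in> E \<Longrightarrow> card e = 2"

definition induced_edges :: "'a set set \<Rightarrow> 'a set \<Rightarrow> 'a set set" where
  "induced_edges E X = {e \<in> E. e \<subseteq> X}"

text \<open>This is $\|X\|$, the number of edges of $G[X]$.\<close>

definition num_edges :: "'a set set \<Rightarrow> 'a set \<Rightarrow> nat" where
  "num_edges E X = card (induced_edges E X)"

lemma (in finite_simple_graph) num_edges_V: "num_edges E V = card E"
proof -
  have "induced_edges E V = E"
    unfolding induced_edges_def using edge_subset by blast
  then show ?thesis
    by (simp add: num_edges_def)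
qed

end

theory Submission
  imports Defs
begin

text \<open>
  Write \<open>f(X) = ||X|| - s |X|\<close> and \<open>g(X) = ||X|| - t |X|\<close>, and suppose that for every nonempty
  proper subset \<open>X\<close> of \<open>V\<close> one of \<open>f(X)\<close>, \<open>g(V - X)\<close> is negative. Regard the subsets of \<open>V\<close> as
  the corners of a cube and send \<open>X\<close> to the point \<open>(f(X), g(V - X))\<close> of the plane. Every edge of the
  cube, from \<open>A\<close> to \<open>A \<union> {v}\<close>, becomes a segment. Two facts about these segments contradict each
  other.

  First, some segment meets the open positive quadrant. A fractional subset of \<open>V\<close> with constant
  weights has both (suitably relaxed) surpluses positive because of the density of the graph; the
  relaxation is such that two fractional weights can always be moved together until one of them is
  integral without losing positivity (\<open>rounding\<close>), so that in the end only one weight is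
  fractional (\<open>fractional_split\<close>). Since no corner, other than the two trivial ones, is sent to
  the closed quadrant, this segment crosses the ray \<open>(t+1)\<^sup>2 f = (s+1)\<^sup>2 g\<close>, \<open>f > 0\<close>.

  Secondly, take a segment, for \<open>A\<close> and \<open>v\<close> with \<open>B = V - A - {v}\<close>, that crosses the ray farthest
  from the origin. For any further vertex \<open>z\<close> the edges \<open>v\<close> and \<open>z\<close> span a square of the cube. Its
  boundary changes sides of the ray's line an even number of times, hence on another edge of the
  square, and that crossing is not farther out. This comparison is a linear inequality between the
  degrees of \<open>z\<close> into \<open>A\<close> and into \<open>B\<close> (\<open>remove_from_A\<close>, \<open>remove_from_B\<close>). Summed over all \<open>z\<close> in
  \<open>A\<close> and over all \<open>z\<close> in \<open>B\<close> it says that there are few edges between \<open>A\<close> and \<open>B\<close>, whereas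
  the density forces many, because few edges run inside \<open>A\<close> and \<open>B\<close>: in the main case
  \<open>||A|| < s |A|\<close> and \<open>||B|| < t |B|\<close>, and otherwise this holds after adding \<open>v\<close> to each.

  The margin is thin: if \<open>2 s\<close> and \<open>2 t\<close> slightly exceed integers \<open>i\<close> and \<open>j\<close>, then the complete
  graph with \<open>i + j + 3\<close> vertices has no such partition and almost the required density. Therefore a
  correction must not be lost that comes from neighbours \<open>z\<close> of \<open>v\<close>, for which the place of the
  second crossing matters. It is bounded from below in \<open>neighbour_sum\<close>, with a free factor whose
  best choice depends on the degrees of \<open>v\<close>; that a good choice exists is the purely arithmetic lemma \<open>multipliers\<close>. The slope of the ray is chosen for
  this last step: for \<open>d \<ge> 0\<close> it makes the slack in \<open>slack_identity\<close> a sum of nonnegative terms.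
\<close>

section \<open>Edges and degrees\<close>

context finite_simple_graph begin

definition adj :: "'a \<Rightarrow> 'a \<Rightarrow> real" where
  "adj u v = of_bool ({u, v} \<in> E)"

definition deg :: "'a set \<Rightarrow> 'a \<Rightarrow> real" where
  "deg X v = (\<Sum>u\<in>X. adj u v)"

definition surplus :: "real \<Rightarrow> 'a set \<Rightarrow> real" where
  "surplus c X = real (num_edges E X) - c * real (card X)"

lemma adj_commute: "adj u v = adj v u"
  by (simp add: adj_def insert_commute)

lemma adj_self [simp]: "adj v v = 0"
  using edge_card[of "{v}"] by (auto simp: adj_def)

lemma adj_01: "adj u v = 0 \<or> adj u v = 1"
  by (simp add: adj_def)

lemma adj_nonneg [simp]: "0 \<le> adj u v" and adj_le_1 [simp]: "adj u v \<le> 1"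
  by (simp_all add: adj_def)

lemma deg_nonneg [simp]: "0 \<le> deg X v"
  by (simp add: deg_def sum_nonneg)

lemma deg_le_card: "finite X \<Longrightarrow> deg X v \<le> real (card X)"
  unfolding deg_def using sum_bounded_above[of X "\<lambda>u. adj u v" 1] by simp

lemma deg_empty [simp]: "deg {} v = 0"
  by (simp add: deg_def)

lemma deg_insert: "finite X \<Longrightarrow> w \<notin> X \<Longrightarrow> deg (insert w X) v = adj w v + deg X v"
  by (simp add: deg_def)

lemma deg_union: "finite X \<Longrightarrow> finite Y \<Longrightarrow> X \<inter> Y = {} \<Longrightarrow> deg (X \<union> Y) v = deg X v + deg Y v"
  by (simp add: deg_def sum.union_disjoint)

lemma sum_deg_swap: "(\<Sum>z\<in>X. deg Y z) = (\<Sum>z\<in>Y. deg X z)"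
proof -
  have "(\<Sum>z\<in>X. deg Y z) = (\<Sum>z\<in>Y. \<Sum>u\<in>X. adj z u)"
    unfolding deg_def by (rule sum.swap)
  then show ?thesis by (simp add: deg_def adj_commute)
qed

lemma num_edges_empty [simp]: "num_edges E {} = 0"
proof -
  have "induced_edges E {} = {}"
    using edge_card by (fastforce simp: induced_edges_def)
  then show ?thesis by (simp add: num_edges_def)
qed

lemma num_edges_insert:
  assumes "finite X" and "v \<notin> X"
  shows "real (num_edges E (insert v X)) = real (num_edges E X) + deg X v"
proof -
  let ?N = "{u \<in> X. {u, v} \<in> E}"
  have "induced_edges E (insert v X) = induced_edges E X \<union> (\<lambda>u. {u, v}) ` ?N"
  proof (intro equalityI subsetI)
    fix e assume e: "e \<in> induced_edges E (insert v X)"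
    then have eE: "e \<in> E" and sub: "e \<subseteq> insert v X" by (auto simp: induced_edges_def)
    show "e \<in> induced_edges E X \<union> (\<lambda>u. {u, v}) ` ?N"
    proof (cases "v \<in> e")
      case True
      obtain u w where "e = {u, w}" "u \<noteq> w"
        using edge_card[OF eE] by (auto simp: card_2_iff)
      with True obtain u where "e = {u, v}" "u \<noteq> v" by blast
      with eE sub show ?thesis by auto
    next
      case False
      with eE sub show ?thesis by (auto simp: induced_edges_def)
    qed
  qed (auto simp: induced_edges_def)
  moreover have "induced_edges E X \<inter> (\<lambda>u. {u, v}) ` ?N = {}"
    using assms(2) by (auto simp: induced_edges_def)
  moreover have "finite (induced_edges E X)"
    by (rule finite_subset[of _ "Pow X"]) (auto simp: induced_edges_def assms(1))
  moreover have "card ((\<lambda>u. {u, v}) ` ?N) = card ?N"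
    using assms(2) by (intro card_image) (auto simp: inj_on_def doubleton_eq_iff)
  ultimately have "num_edges E (insert v X) = num_edges E X + card ?N"
    using assms(1) by (simp add: num_edges_def card_Un_disjoint)
  moreover have "deg X v = real (card ?N)"
    using assms(1) by (simp add: deg_def adj_def of_bool_def sum.If_cases Int_def)
  ultimately show ?thesis by simp
qed

lemma surplus_insert:
  "finite X \<Longrightarrow> v \<notin> X \<Longrightarrow> surplus c (insert v X) = surplus c X + deg X v - c"
  by (simp add: surplus_def num_edges_insert algebra_simps)

lemma surplus_empty [simp]: "surplus c {} = 0"
  by (simp add: surplus_def)

text \<open>The handshake lemma.\<close>

lemma sum_deg: "finite X \<Longrightarrow> (\<Sum>z\<in>X. deg X z) = 2 * real (num_edges E X)"
proof (induction X rule: finite_induct)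
  case (insert v X)
  have "(\<Sum>z\<in>insert v X. deg (insert v X) z) = deg X v + (\<Sum>z\<in>X. adj v z) + (\<Sum>z\<in>X. deg X z)"
    using insert by (simp add: deg_insert sum.distrib)
  then show ?case
    using insert by (simp add: num_edges_insert deg_def adj_commute)
qed simp

lemma num_edges_union:
  assumes "finite X" and "finite Y" and "X \<inter> Y = {}"
  shows "real (num_edges E (X \<union> Y))
    = real (num_edges E X) + real (num_edges E Y) + (\<Sum>z\<in>X. deg Y z)"
  using assms
proof (induction X rule: finite_induct)
  case (insert v X)
  then have "num_edges E (insert v X \<union> Y) = num_edges E (X \<union> Y) + deg (X \<union> Y) v"
    by (simp add: num_edges_insert)
  then show ?case
    using insert by (simp add: num_edges_insert deg_union)
qed simp

end

section \<open>Rounding a fractional subset\<close>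

text \<open>Two closed half-planes through the origin share a nonzero vector: a vector along the
  boundary of the first one, with the right sign, lies in the second.\<close>

lemma common_direction:
  fixes a b c d :: real
  shows "\<exists>x y. (x \<noteq> 0 \<or> y \<noteq> 0) \<and> a*x + b*y \<ge> 0 \<and> c*x + d*y \<ge> 0"
proof (cases "a = 0 \<and> b = 0")
  case True
  show ?thesis
  proof (cases "c = 0 \<and> d = 0")
    case True
    with \<open>a = 0 \<and> b = 0\<close> show ?thesis by (intro exI[of _ 1] exI[of _ 0]) simp
  next
    case False
    with \<open>a = 0 \<and> b = 0\<close> show ?thesis by (intro exI[of _ c] exI[of _ d]) auto
  qed
next
  case ab: False
  show ?thesis
  proof (cases "d*a - c*b \<ge> 0")
    case True
    with ab show ?thesis by (intro exI[of _ "-b"] exI[of _ a]) (auto simp: algebra_simps)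
  next
    case False
    with ab show ?thesis by (intro exI[of _ b] exI[of _ "-a"]) (auto simp: algebra_simps)
  qed
qed

lemma interval_exit:
  fixes x d :: real
  assumes "0 < x" and "x < 1" and "d \<noteq> 0"
  shows "\<exists>r\<ge>0. x + r*d \<in> {0,1} \<and> (\<forall>r'. 0 \<le> r' \<and> r' \<le> r \<longrightarrow> 0 \<le> x + r'*d \<and> x + r'*d \<le> 1)"
proof (cases "d > 0")
  case True
  show ?thesis
  proof (intro exI[of _ "(1-x)/d"] conjI allI impI)
    fix r' assume r: "0 \<le> r' \<and> r' \<le> (1-x)/d"
    then have "0 \<le> r'*d" "r'*d \<le> 1-x" using True by (simp_all add: le_divide_eq)
    then show "0 \<le> x + r'*d" "x + r'*d \<le> 1" using assms by simp_all
  qed (use True assms in auto)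
next
  case False
  with assms have d: "d < 0" by simp
  show ?thesis
  proof (intro exI[of _ "x/(-d)"] conjI allI impI)
    fix r' assume r: "0 \<le> r' \<and> r' \<le> x/(-d)"
    have "0 \<le> r'*(-d)" using r d by (intro mult_nonneg_nonneg) auto
    moreover have "r'*(-d) \<le> x" using r d pos_le_divide_eq[of "-d" r' x] by simp
    ultimately show "0 \<le> x + r'*d" "x + r'*d \<le> 1" using assms by simp_all
  qed (use d assms in \<open>auto simp: divide_nonneg_neg\<close>)
qed

text \<open>The ray stays in the square up to the earlier of the two times at which a coordinate
  reaches an end of its interval.\<close>

lemma box_exit:
  fixes x y d e :: real
  assumes x: "0 < x" "x < 1" and y: "0 < y" "y < 1" and de: "d \<noteq> 0 \<or> e \<noteq> 0"
  shows "\<exists>r\<ge>0. 0 \<le> x + r*d \<and> x + r*d \<le> 1 \<and> 0 \<le> y + r*e \<and> y + r*e \<le> 1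
    \<and> (x + r*d \<in> {0,1} \<or> y + r*e \<in> {0,1})"
proof -
  consider "d = 0" | "e = 0" | "d \<noteq> 0" "e \<noteq> 0" by blast
  then show ?thesis
  proof cases
    case 1
    with interval_exit[OF y, of e] de x show ?thesis by auto
  next
    case 2
    with interval_exit[OF x, of d] de y show ?thesis by auto
  next
    case 3
    obtain r1 where r1: "r1 \<ge> 0" "x + r1*d \<in> {0,1}"
        "\<forall>r'. 0 \<le> r' \<and> r' \<le> r1 \<longrightarrow> 0 \<le> x + r'*d \<and> x + r'*d \<le> 1"
      using interval_exit[OF x 3(1)] by blast
    obtain r2 where r2: "r2 \<ge> 0" "y + r2*e \<in> {0,1}"
        "\<forall>r'. 0 \<le> r' \<and> r' \<le> r2 \<longrightarrow> 0 \<le> y + r'*e \<and> y + r'*e \<le> 1"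
      using interval_exit[OF y 3(2)] by blast
    show ?thesis
      by (rule exI[of _ "min r1 r2"]) (use r1 r2 in \<open>auto simp: min_def\<close>)
  qed
qed

context finite_simple_graph begin

text \<open>On the indicator of a set this is the surplus of that set. The diagonal terms agree with
  \<open>x u / 2\<close> when \<open>x u\<close> is 0 or 1; they are there so that the quadratic part has nonnegative
  values on all vectors with two nonzero entries, which a form with zero diagonal does not.\<close>

definition quad :: "real \<Rightarrow> ('a \<Rightarrow> real) \<Rightarrow> real" where
  "quad c x = (\<Sum>u\<in>V. \<Sum>w\<in>V. (adj u w + of_bool (u = w)) * x u * x w) / 2 - (c + 1/2) * (\<Sum>u\<in>V. x u)"

text \<open>The partial derivative of \<open>quad c\<close> at \<open>x\<close> in the coordinate \<open>v\<close>.\<close>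

definition slope :: "real \<Rightarrow> ('a \<Rightarrow> real) \<Rightarrow> 'a \<Rightarrow> real" where
  "slope c x v = (\<Sum>w\<in>V. adj v w * x w) + x v - (c + 1/2)"

lemma quad_cong: "(\<And>u. u \<in> V \<Longrightarrow> x u = y u) \<Longrightarrow> quad c x = quad c y"
  by (simp add: quad_def)

lemma quad_add:
  "quad c (\<lambda>u. x u + y u) = quad c x + (\<Sum>u\<in>V. y u * slope c x u)
     + (\<Sum>u\<in>V. \<Sum>w\<in>V. (adj u w + of_bool (u = w)) * y u * y w) / 2"
proof -
  let ?K = "\<lambda>u w. adj u w + of_bool (u = w) :: real"
  have sym: "(\<Sum>u\<in>V. \<Sum>w\<in>V. ?K u w * x u * y w) = (\<Sum>u\<in>V. \<Sum>w\<in>V. ?K u w * y u * x w)"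
  proof -
    have K: "?K u w = ?K w u" for u w
      using adj_commute[of u w] by auto
    have "(\<Sum>u\<in>V. \<Sum>w\<in>V. ?K u w * x u * y w) = (\<Sum>w\<in>V. \<Sum>u\<in>V. ?K u w * x u * y w)"
      by (rule sum.swap)
    also have "\<dots> = (\<Sum>u\<in>V. \<Sum>w\<in>V. ?K u w * y u * x w)"
      by (intro sum.cong refl, subst K) (simp only: mult_ac)
    finally show ?thesis .
  qed
  have "(\<Sum>u\<in>V. y u * slope c x u)
      = (\<Sum>u\<in>V. \<Sum>w\<in>V. ?K u w * y u * x w) - (c + 1/2) * (\<Sum>u\<in>V. y u)"
  proof -
    have "y u * slope c x u = (\<Sum>w\<in>V. ?K u w * y u * x w) - (c + 1/2) * y u" if "u \<in> V" for u
    proof -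
      have "(\<Sum>w\<in>V. ?K u w * y u * x w) = (\<Sum>w\<in>V. y u * (adj u w * x w) + (if u = w then y u * x w else 0))"
        by (intro sum.cong refl) (simp add: algebra_simps)
      also have "\<dots> = y u * (\<Sum>w\<in>V. adj u w * x w) + y u * x u"
        using that finite_V by (simp add: sum.distrib sum_distrib_left)
      finally show ?thesis by (simp add: slope_def algebra_simps)
    qed
    then show ?thesis by (simp add: sum_subtractf sum_distrib_left)
  qed
  moreover have "(\<Sum>u\<in>V. \<Sum>w\<in>V. ?K u w * (x u + y u) * (x w + y w))
     = (\<Sum>u\<in>V. \<Sum>w\<in>V. ?K u w * x u * x w) + (\<Sum>u\<in>V. \<Sum>w\<in>V. ?K u w * x u * y w)
     + (\<Sum>u\<in>V. \<Sum>w\<in>V. ?K u w * y u * x w) + (\<Sum>u\<in>V. \<Sum>w\<in>V. ?K u w * y u * y w)"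
    unfolding sum.distrib[symmetric] by (intro sum.cong refl) (simp only: ring_distribs)
  ultimately show ?thesis
    unfolding quad_def sym sum.distrib by (simp add: field_simps)
qed

lemma quad_move:
  assumes "v \<in> V"
  shows "quad c (x(v := x v + h)) = quad c x + h * slope c x v + h^2 / 2"
proof -
  let ?y = "\<lambda>u. if u = v then h else 0"
  have "quad c (x(v := x v + h)) = quad c (\<lambda>u. x u + ?y u)"
    by (rule quad_cong) simp
  also have "\<dots> = quad c x + (\<Sum>u\<in>V. ?y u * slope c x u)
     + (\<Sum>u\<in>V. \<Sum>w\<in>V. (adj u w + of_bool (u = w)) * ?y u * ?y w) / 2"
    by (rule quad_add)
  also have "(\<Sum>u\<in>V. ?y u * slope c x u) = h * slope c x v"
  proof -
    have "(\<Sum>u\<in>V. ?y u * slope c x u) = (\<Sum>u\<in>V. if u = v then h * slope c x u else 0)"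
      by (intro sum.cong) auto
    then show ?thesis using assms finite_V by simp
  qed
  also have "(\<Sum>u\<in>V. \<Sum>w\<in>V. (adj u w + of_bool (u = w)) * ?y u * ?y w) = h^2"
  proof -
    have "(\<Sum>w\<in>V. (adj u w + of_bool (u = w)) * ?y u * ?y w)
       = (\<Sum>w\<in>V. if w = v then (if u = v then h^2 else 0) else 0)" for u
      by (intro sum.cong) (auto simp: power2_eq_square)
    then show ?thesis using assms finite_V by simp
  qed
  finally show ?thesis .
qed

lemma slope_move:
  assumes "u \<in> V" and "v \<noteq> u"
  shows "slope c (x(u := x u + h)) v = slope c x v + adj v u * h"
proof -
  have "(\<Sum>w\<in>V. adj v w * (x(u := x u + h)) w) = (\<Sum>w\<in>V. adj v w * x w + (if w = u then adj v u * h else 0))"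
    by (intro sum.cong) (auto simp: algebra_simps)
  then show ?thesis using assms finite_V by (simp add: slope_def sum.distrib)
qed

lemma slope_of_bool:
  assumes "A \<subseteq> V" and "v \<notin> A"
  shows "slope c (\<lambda>u. of_bool (u \<in> A)) v = deg A v - (c + 1/2)"
  using assms finite_V
  by (simp add: slope_def deg_def of_bool_def adj_commute sum.If_cases Int_absorb1 if_distrib cong: if_cong)

lemma quad_of_bool:
  assumes "A \<subseteq> V"
  shows "quad c (\<lambda>u. of_bool (u \<in> A)) = surplus c A"
  using finite_subset[OF assms finite_V] assms
proof (induction A rule: finite_induct)
  case empty
  then show ?case by (simp add: quad_def)
next
  case (insert v A)
  let ?x = "\<lambda>u. of_bool (u \<in> A) :: real"
  have "(\<lambda>u. of_bool (u \<in> insert v A)) = ?x(v := ?x v + 1)"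
    using insert by auto
  then have "quad c (\<lambda>u. of_bool (u \<in> insert v A)) = quad c ?x + slope c ?x v + 1/2"
    using quad_move[of v c ?x 1] insert by simp
  moreover have "slope c ?x v = deg A v - (c + 1/2)"
    using insert by (intro slope_of_bool) auto
  ultimately show ?case
    using insert by (simp add: surplus_insert)
qed

lemma quad_const:
  "quad c (\<lambda>u. p) = p^2 * (real (num_edges E V) + real (card V) / 2) - (c + 1/2) * p * real (card V)"
proof -
  have "(\<Sum>u\<in>V. \<Sum>w\<in>V. (adj u w + of_bool (u = w)) * p * p) = (\<Sum>u\<in>V. \<Sum>w\<in>V. adj u w + of_bool (u = w)) * p^2"
    by (simp add: sum_distrib_right power2_eq_square mult.assoc)
  also have "(\<Sum>u\<in>V. \<Sum>w\<in>V. adj u w + of_bool (u = w)) = 2 * real (num_edges E V) + real (card V)"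
    using sum_deg[OF finite_V] finite_V by (simp add: sum.distrib deg_def adj_commute of_bool_def)
  finally show ?thesis by (simp add: quad_def field_simps)
qed

text \<open>The second-order part is at least 0, as \<open>(h\<^sup>2 + k\<^sup>2) / 2 + h k adj v u\<close> is a mean of
  \<open>(h + k)\<^sup>2 / 2\<close> and \<open>(h\<^sup>2 + k\<^sup>2) / 2\<close>.\<close>

lemma quad_move2:
  assumes "u \<in> V" and "v \<in> V" and "u \<noteq> v"
  shows "quad c x + h * slope c x u + k * slope c x v
    \<le> quad c (x(u := x u + h, v := x v + k))"
proof -
  let ?x = "x(u := x u + h)"
  have "quad c (x(u := x u + h, v := x v + k)) = quad c (?x(v := ?x v + k))"
    using assms(3) by simp
  also have "\<dots> = quad c x + h * slope c x u + h^2/2 + k * (slope c x v + adj v u * h) + k^2/2"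
    using assms quad_move[of v c ?x k] quad_move[of u c x h] slope_move[of u v c x h] by simp
  also have "\<dots> = quad c x + h * slope c x u + k * slope c x v
      + (adj v u * (h + k)^2 + (1 - adj v u) * (h^2 + k^2)) / 2"
    by (simp add: power2_eq_square field_simps)
  finally show ?thesis by simp
qed

definition fractional :: "('a \<Rightarrow> real) \<Rightarrow> 'a set" where
  "fractional x = {u \<in> V. x u \<noteq> 0 \<and> x u \<noteq> 1}"

text \<open>Two fractional coordinates leave a plane of directions, and in it some direction in which
  neither value decreases to first order; by \<open>quad_move2\<close> neither decreases at all. Moving along
  it until the box is left makes a coordinate integral.\<close>

lemma rounding:
  assumes "\<forall>u\<in>V. 0 \<le> x u \<and> x u \<le> 1" and "quad c x > 0" and "quad d (\<lambda>u. 1 - x u) > 0"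
  shows "\<exists>y. (\<forall>u\<in>V. 0 \<le> y u \<and> y u \<le> 1) \<and> quad c y > 0 \<and> quad d (\<lambda>u. 1 - y u) > 0
    \<and> card (fractional y) \<le> 1"
  using assms
proof (induction "card (fractional x)" arbitrary: x rule: less_induct)
  case less
  show ?case
  proof (cases "card (fractional x) \<le> 1")
    case True
    with less.prems show ?thesis by blast
  next
    case False
    have fin: "finite (fractional x)" using finite_V by (simp add: fractional_def)
    obtain u v where uv: "u \<in> fractional x" "v \<in> fractional x" "u \<noteq> v"
      using False fin card_le_Suc0_iff_eq by (metis One_nat_def)
    then have V: "u \<in> V" "v \<in> V" by (auto simp: fractional_def)
    have box: "0 < x u" "x u < 1" "0 < x v" "x v < 1"
      using uv less.prems(1) by (force simp: fractional_def less_le)+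
    let ?z = "\<lambda>w. 1 - x w"
    obtain p q where pq: "p \<noteq> 0 \<or> q \<noteq> 0" "slope c x u * p + slope c x v * q \<ge> 0"
        "(- slope d ?z u) * p + (- slope d ?z v) * q \<ge> 0"
      using common_direction by blast
    obtain r where r: "r \<ge> 0" "0 \<le> x u + r*p" "x u + r*p \<le> 1" "0 \<le> x v + r*q" "x v + r*q \<le> 1"
        "x u + r*p \<in> {0,1} \<or> x v + r*q \<in> {0,1}"
      using box_exit[OF box pq(1)] by blast
    define y where "y = x(u := x u + r*p, v := x v + r*q)"
    have "0 \<le> r * (slope c x u * p + slope c x v * q)" using pq r by simp
    then have qc: "quad c y > 0"
      using quad_move2[OF V uv(3), of c x "r*p" "r*q"] less.prems(2)
      by (simp add: y_def algebra_simps)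
    have "(\<lambda>w. 1 - y w) = ?z(u := ?z u + (- (r*p)), v := ?z v + (- (r*q)))"
      using uv(3) by (auto simp: y_def)
    moreover have "0 \<le> r * ((- slope d ?z u) * p + (- slope d ?z v) * q)" using pq r by simp
    ultimately have qd: "quad d (\<lambda>w. 1 - y w) > 0"
      using quad_move2[OF V uv(3), of d ?z "- (r*p)" "- (r*q)"] less.prems(3)
      by (simp add: algebra_simps)
    have "fractional y \<subset> fractional x"
      using uv V r(6) by (auto simp: fractional_def y_def)
    then have "card (fractional y) < card (fractional x)"
      using fin by (rule psubset_card_mono[rotated])
    moreover have "\<forall>w\<in>V. 0 \<le> y w \<and> y w \<le> 1"
      using less.prems(1) r by (simp add: y_def)
    ultimately show ?thesis using less.hyps qc qd by blast
  qed
qed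

text \<open>Constant weights \<open>p\<close>, where \<open>p\<close> is to \<open>1 - p\<close> as \<open>2 s + 3/2\<close> to \<open>2 t + 3/2\<close>, make both
  quadratic values positive.
  After rounding, one vertex \<open>v\<close> has a weight \<open>\<tau>\<close> that may be fractional, and there the quadratic
  value is less than the linear interpolation by \<open>\<tau> (1 - \<tau>) / 2\<close>.\<close>

lemma fractional_split:
  assumes s: "s > 0" and t: "t > 0" and V: "V \<noteq> {}"
    and dense: "(s + t + 1) * real (card V) \<le> real (num_edges E V)"
  obtains A v \<tau> where "A \<subseteq> V" "v \<in> V - A" "0 \<le> \<tau>" "\<tau> \<le> 1"
    "surplus s A + \<tau> * (deg A v - s) > 0"
    "surplus t (V - insert v A) + (1 - \<tau>) * (deg (V - insert v A) v - t) > 0"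
proof -
  define N where "N = 2*s + 2*t + 3"
  (* both p * N and (1 - p) * N exceed the thresholds 2s + 1 and 2t + 1, by the same 1/2 *)
  define p where "p = (2*s + 3/2) / N"
  have N: "N > 0" using s t by (simp add: N_def)
  have p: "0 < p" "p < 1" "p * N = 2*s + 3/2" "(1-p) * N = 2*t + 3/2"
    using s t N by (auto simp: p_def field_simps N_def)
  have n: "real (card V) > 0" using V finite_V by (simp add: card_gt_0_iff)
  have pos: "quad c (\<lambda>u. q) > 0" if "q > 0" "q * N = 2*c + 3/2" for c q
  proof -
    have "real (card V) * N / 2 \<le> real (num_edges E V) + real (card V) / 2"
      using dense by (simp add: N_def field_simps)
    then have "q^2 * (real (card V) * N / 2) \<le> q^2 * (real (num_edges E V) + real (card V) / 2)"
      by (intro mult_left_mono) auto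
    moreover have "q^2 * (real (card V) * N / 2) = q * real (card V) * (q * N) / 2"
      by (simp add: power2_eq_square)
    moreover have "q * real (card V) > 0" using that n by simp
    ultimately show ?thesis
      unfolding quad_const that(2) by (simp add: algebra_simps)
  qed
  obtain y where y: "\<forall>u\<in>V. 0 \<le> y u \<and> y u \<le> 1" "quad s y > 0" "quad t (\<lambda>u. 1 - y u) > 0"
      "card (fractional y) \<le> 1"
    using rounding[of "\<lambda>u. p" s t] pos[of p s] pos[of "1-p" t] p by auto
  have fin: "finite (fractional y)" using finite_V by (simp add: fractional_def)
  obtain v where v: "v \<in> V" "fractional y \<subseteq> {v}"
  proof (cases "fractional y = {}")
    case True
    then show thesis using that V by blast
  next
    case False
    then obtain v where "v \<in> fractional y" by blast
    moreover from this have "fractional y \<subseteq> {v}"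
      using y(4) fin card_le_Suc0_iff_eq by (metis One_nat_def singletonI subsetI)
    ultimately show thesis using that by (auto simp: fractional_def)
  qed
  define A where "A = {u \<in> V. u \<noteq> v \<and> y u = 1}"
  define B where "B = V - insert v A"
  have sub: "A \<subseteq> V" "B \<subseteq> V" "v \<notin> A" "v \<notin> B" by (auto simp: A_def B_def)
  have end_value: "0 < surplus c X + h * (deg X v - c)"
    if X: "X \<subseteq> V" "v \<notin> X" and h: "0 \<le> h" "h \<le> 1" and q: "quad c z > 0"
      and z: "\<And>u. u \<in> V \<Longrightarrow> z u = (if u = v then h else of_bool (u \<in> X))" for c X h z
  proof -
    let ?x = "\<lambda>u. of_bool (u \<in> X) :: real"
    have "quad c z = quad c (?x(v := ?x v + h))"
      using X z by (intro quad_cong) simp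
    also have "\<dots> = quad c ?x + h * slope c ?x v + h^2 / 2"
      by (rule quad_move[OF v(1)])
    also have "\<dots> = surplus c X + h * (deg X v - c) - h * (1 - h) / 2"
      unfolding quad_of_bool[OF X(1)] slope_of_bool[OF X] by (simp add: power2_eq_square field_simps)
    finally have "0 < surplus c X + h * (deg X v - c) - h * (1 - h) / 2" using q by simp
    moreover have "0 \<le> h * (1 - h)" using h by (intro mult_nonneg_nonneg) auto
    ultimately show ?thesis by linarith
  qed
  have out: "y u = 0 \<or> y u = 1" if "u \<in> V" "u \<noteq> v" for u
    using that v(2) by (auto simp: fractional_def)
  show thesis
  proof (rule that)
    show "A \<subseteq> V" "v \<in> V - A" "0 \<le> y v" "y v \<le> 1" using sub v(1) y(1) by auto
    show "surplus s A + y v * (deg A v - s) > 0"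
      by (rule end_value[of _ _ _ y]) (use sub y v(1) out in \<open>auto simp: A_def\<close>)
    show "surplus t (V - insert v A) + (1 - y v) * (deg (V - insert v A) v - t) > 0"
      unfolding B_def[symmetric]
      by (rule end_value[of _ _ _ "\<lambda>u. 1 - y u"]) (use sub y v(1) out in \<open>auto simp: A_def B_def\<close>)
  qed
qed

end

section \<open>A segment that crosses the ray farthest out\<close>

lemma sign_change_zero:
  fixes p q :: real
  assumes "(p \<ge> 0) \<noteq> (q \<ge> 0)"
  shows "\<exists>\<tau>. 0 \<le> \<tau> \<and> \<tau> \<le> 1 \<and> (1 - \<tau>) * p + \<tau> * q = 0 \<and> (p \<noteq> 0 \<longrightarrow> 0 < \<tau>)"
proof (intro exI conjI impI)
  have "p - q \<noteq> 0" using assms by auto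
  then show "(1 - p/(p-q)) * p + p/(p-q) * q = 0" by (simp add: field_simps)
  show "0 \<le> p/(p-q)" "p/(p-q) \<le> 1"
    using assms by (auto simp: zero_le_divide_iff divide_le_eq)
  show "0 < p/(p-q)" if "p \<noteq> 0"
    using assms that by (auto simp: zero_less_divide_iff)
qed

text \<open>Between two points outside the closed positive quadrant a segment can pass through the open
  quadrant only by going from one adjacent quadrant to the other one.\<close>

lemma crossing_shape:
  fixes f g \<alpha> \<beta> \<tau> :: real
  assumes \<tau>: "0 \<le> \<tau>" "\<tau> \<le> 1" and F: "f + \<tau>*\<alpha> > 0" and G: "g + (1-\<tau>)*\<beta> > 0"
    and bad: "f < 0 \<or> g + \<beta> < 0" "f + \<alpha> < 0 \<or> g < 0"
  shows "\<alpha> > 0 \<and> \<beta> > 0 \<and> f < 0 \<and> g < 0 \<and> f + \<alpha> > 0 \<and> g + \<beta> > 0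
    \<or> \<alpha> < 0 \<and> \<beta> < 0 \<and> f > 0 \<and> g > 0 \<and> f + \<alpha> < 0 \<and> g + \<beta> < 0"
proof -
  have up: "\<tau>*\<alpha> \<le> max 0 \<alpha>" "(1-\<tau>)*\<beta> \<le> max 0 \<beta>"
    using \<tau> mult_left_le_one_le[of \<alpha> \<tau>] mult_left_le_one_le[of \<beta> "1-\<tau>"]
    by (cases "\<alpha> \<ge> 0"; cases "\<beta> \<ge> 0"; simp add: max_def mult_nonneg_nonpos)+
  show ?thesis using up F G bad unfolding max_def by argo
qed

text \<open>A counterexample to the theorem, to be refuted.\<close>

locale unsplittable = finite_simple_graph V E for V :: "'a set" and E +
  fixes s t :: real
  assumes s: "s > 0" and t: "t > 0" and V_nonempty: "V \<noteq> {}"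
    and dense: "(s + t + 1) * real (card V) \<le> real (num_edges E V)"
    and unsplit: "\<lbrakk>A \<subseteq> V; A \<noteq> {}; A \<noteq> V\<rbrakk> \<Longrightarrow> surplus s A < 0 \<or> surplus t (V - A) < 0"
begin

text \<open>The side of the line through the ray on which the point of \<open>X\<close> lies.\<close>

definition balance :: "'a set \<Rightarrow> real" where
  "balance X = (t+1)^2 * surplus s X - (s+1)^2 * surplus t (V - X)"

text \<open>The segment from the point of \<open>X\<close> to that of \<open>insert v X\<close> meets the line of the ray at the
  parameter \<open>\<tau>\<close>. Points on the line itself are counted with the positive side; this convention
  makes the number of sign changes around a square even in all cases.\<close>

definition crossing :: "'a set \<Rightarrow> 'a \<Rightarrow> real \<Rightarrow> bool" where
  "crossing X v \<tau> \<longleftrightarrow> X \<subseteq> V \<and> v \<in> V - X \<and> (balance X \<ge> 0) \<noteq> (balance (insert v X) \<ge> 0)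
     \<and> 0 \<le> \<tau> \<and> \<tau> \<le> 1 \<and> (1 - \<tau>) * balance X + \<tau> * balance (insert v X) = 0"

text \<open>The first coordinate of the crossing point; on the ray it measures the distance from the
  origin.\<close>

definition level :: "'a set \<Rightarrow> 'a \<Rightarrow> real \<Rightarrow> real" where
  "level X v \<tau> = (1 - \<tau>) * surplus s X + \<tau> * surplus s (insert v X)"

text \<open>Density bounds the number of vertices from below, as every degree is at most that number.\<close>

lemma large: "s + t < real (card V)"
proof -
  have n: "real (card V) > 0" using V_nonempty finite_V by (simp add: card_gt_0_iff)
  have "2 * ((s + t + 1) * real (card V)) \<le> (\<Sum>v\<in>V. deg V v)"
    using dense by (simp add: sum_deg finite_V)
  also have "\<dots> \<le> real (card V) * real (card V)"
    using sum_bounded_above[of V "deg V" "real (card V)"] deg_le_card finite_V by simp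
  finally have "2 * (s + t + 1) \<le> real (card V)" using n by simp
  with s t show ?thesis by simp
qed

lemma along_edge:
  assumes "A \<subseteq> V" and "v \<in> V - A"
  defines "B \<equiv> V - insert v A"
  shows "surplus s (insert v A) = surplus s A + (deg A v - s)"
    and "surplus t (V - A) = surplus t B + (deg B v - t)"
proof -
  have fin: "finite A" "finite B" using assms finite_V finite_subset by (auto simp: B_def)
  show "surplus s (insert v A) = surplus s A + (deg A v - s)"
    using assms fin by (simp add: surplus_insert)
  have VA: "V - A = insert v B" and v: "v \<notin> B" using assms by (auto simp: B_def)
  show "surplus t (V - A) = surplus t B + (deg B v - t)"
    unfolding VA using fin v by (simp add: surplus_insert)
qed

text \<open>A segment that enters the open quadrant has both ends at nontrivial sets, since from a trivial
  one a surplus would be a nonpositive multiple of \<open>s\<close> or of \<open>t\<close>. So \<open>crossing_shape\<close> applies, and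
  the two ends are strictly on different sides of the ray.\<close>

lemma positive_point_shape:
  assumes A: "A \<subseteq> V" "v \<in> V - A" and \<tau>: "0 \<le> \<tau>" "\<tau> \<le> 1"
  defines "B \<equiv> V - insert v A"
  assumes F: "surplus s A + \<tau> * (deg A v - s) > 0" and G: "surplus t B + (1 - \<tau>) * (deg B v - t) > 0"
  shows "A \<noteq> {}" and "B \<noteq> {}"
    and "deg A v - s > 0 \<and> deg B v - t > 0 \<and> surplus s A < 0 \<and> surplus t B < 0
        \<and> balance A < 0 \<and> balance (insert v A) > 0
      \<or> deg A v - s < 0 \<and> deg B v - t < 0
        \<and> surplus s (insert v A) < 0 \<and> surplus t (V - A) < 0
        \<and> balance A > 0 \<and> balance (insert v A) < 0"
proof -
  have "0 \<le> \<tau> * s" "0 \<le> (1 - \<tau>) * t" using s t \<tau> by simp_all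
  then show ne: "A \<noteq> {}" "B \<noteq> {}" using F G by auto
  note edge = along_edge[OF A, folded B_def]
  have "surplus s A < 0 \<or> surplus t B + (deg B v - t) < 0"
    using unsplit[of A] edge A ne by auto
  moreover have "surplus s A + (deg A v - s) < 0 \<or> surplus t B < 0"
    using unsplit[of "insert v A"] edge A ne by (auto simp: B_def)
  ultimately have shape: "deg A v - s > 0 \<and> deg B v - t > 0 \<and> surplus s A < 0 \<and> surplus t B < 0
       \<and> surplus s A + (deg A v - s) > 0 \<and> surplus t B + (deg B v - t) > 0
     \<or> deg A v - s < 0 \<and> deg B v - t < 0 \<and> surplus s A > 0 \<and> surplus t B > 0
       \<and> surplus s A + (deg A v - s) < 0 \<and> surplus t B + (deg B v - t) < 0"
    using crossing_shape[OF \<tau> F G] by blast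
  have K: "(t+1)^2 > 0" "(s+1)^2 > 0" using s t by simp_all
  have opp: "(t+1)^2 * x - (s+1)^2 * y > 0" if "x > 0" "y < 0" for x y
    using mult_pos_pos[OF K(1) that(1)] mult_pos_neg[OF K(2) that(2)] by simp
  have opp': "(t+1)^2 * x - (s+1)^2 * y < 0" if "x < 0" "y > 0" for x y
    using mult_pos_neg[OF K(1) that(1)] mult_pos_pos[OF K(2) that(2)] by simp
  show "deg A v - s > 0 \<and> deg B v - t > 0 \<and> surplus s A < 0 \<and> surplus t B < 0
        \<and> balance A < 0 \<and> balance (insert v A) > 0
      \<or> deg A v - s < 0 \<and> deg B v - t < 0
        \<and> surplus s (insert v A) < 0 \<and> surplus t (V - A) < 0
        \<and> balance A > 0 \<and> balance (insert v A) < 0"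
    using shape
  proof
    assume h: "deg A v - s > 0 \<and> deg B v - t > 0 \<and> surplus s A < 0 \<and> surplus t B < 0
       \<and> surplus s A + (deg A v - s) > 0 \<and> surplus t B + (deg B v - t) > 0"
    then have "balance A < 0" "balance (insert v A) > 0"
      unfolding balance_def B_def[symmetric] edge by (intro opp opp'; blast)+
    with h show ?thesis by blast
  next
    assume h: "deg A v - s < 0 \<and> deg B v - t < 0 \<and> surplus s A > 0 \<and> surplus t B > 0
       \<and> surplus s A + (deg A v - s) < 0 \<and> surplus t B + (deg B v - t) < 0"
    then have "balance A > 0" "balance (insert v A) < 0"
      unfolding balance_def B_def[symmetric] edge by (intro opp opp'; blast)+
    with h edge show ?thesis by simp
  qed
qed

text \<open>Along the segment given by \<open>fractional_split\<close> one coordinate increases and the other one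
  decreases. Going from its positive point to the crossing, one of them does not decrease and stays
  positive, and on the ray the other has the same sign.\<close>

lemma ex_positive_crossing: "\<exists>A v \<tau>. crossing A v \<tau> \<and> level A v \<tau> > 0"
proof -
  obtain A v \<rho> where A: "A \<subseteq> V" "v \<in> V - A" and \<rho>: "0 \<le> \<rho>" "\<rho> \<le> 1"
    and F: "surplus s A + \<rho> * (deg A v - s) > 0"
    and G: "surplus t (V - insert v A) + (1 - \<rho>) * (deg (V - insert v A) v - t) > 0"
    by (rule fractional_split[OF s t V_nonempty dense])
  define B where "B = V - insert v A"
  define \<alpha> \<beta> where "\<alpha> = deg A v - s" and "\<beta> = deg B v - t"
  note edge = along_edge[OF A, folded B_def, folded \<alpha>_def \<beta>_def]
  note shape = positive_point_shape(3)[OF A \<rho> F G, folded B_def, folded \<alpha>_def \<beta>_def]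
  have change: "(balance A \<ge> 0) \<noteq> (balance (insert v A) \<ge> 0)" using shape by linarith
  obtain \<tau> where \<tau>: "0 \<le> \<tau>" "\<tau> \<le> 1" "(1 - \<tau>) * balance A + \<tau> * balance (insert v A) = 0"
    using sign_change_zero[OF change] by blast
  have level: "level A v \<tau> = surplus s A + \<tau> * \<alpha>"
    unfolding level_def edge by (simp add: algebra_simps)
  have eq: "(t+1)^2 * (surplus s A + \<tau> * \<alpha>) = (s+1)^2 * (surplus t B + (1-\<tau>) * \<beta>)"
    using \<tau>(3) unfolding balance_def B_def[symmetric] edge by (simp add: algebra_simps)
  have K: "(t+1)^2 > 0" "(s+1)^2 > 0" using s t by simp_all
  have "surplus s A + \<tau> * \<alpha> > 0"
  proof (cases "\<rho> * \<alpha> \<le> \<tau> * \<alpha>")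
    case True
    then show ?thesis using F by (simp add: \<alpha>_def)
  next
    case False
    then have "(1-\<rho>) * \<beta> \<le> (1-\<tau>) * \<beta>"
      using shape by (auto simp: mult_le_cancel_right)
    then have "surplus t B + (1-\<tau>) * \<beta> > 0" using G by (simp add: B_def \<beta>_def)
    then have "(t+1)^2 * (surplus s A + \<tau> * \<alpha>) > 0" unfolding eq using K by simp
    then show ?thesis using K zero_less_mult_pos by blast
  qed
  then have "crossing A v \<tau> \<and> level A v \<tau> > 0"
    using A \<tau> change level by (simp add: crossing_def)
  then show ?thesis by blast
qed

lemma finite_crossings: "finite {(A, v, \<tau>). crossing A v \<tau>}"
proof (rule finite_subset)
  let ?f = "\<lambda>(A, v). (A, v, balance A / (balance A - balance (insert v A)))"
  show "finite (?f ` (Pow V \<times> V))" using finite_V by simp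
  show "{(A, v, \<tau>). crossing A v \<tau>} \<subseteq> ?f ` (Pow V \<times> V)"
  proof clarify
    fix A v \<tau> assume c: "crossing A v \<tau>"
    then have "balance A - balance (insert v A) \<noteq> 0" by (auto simp: crossing_def)
    moreover have "\<tau> * (balance A - balance (insert v A)) = balance A"
      using c by (simp add: crossing_def algebra_simps)
    ultimately have "\<tau> = balance A / (balance A - balance (insert v A))" by (simp add: eq_divide_eq)
    then show "(A, v, \<tau>) \<in> ?f ` (Pow V \<times> V)" using c by (auto simp: crossing_def)
  qed
qed

lemma ex_top_crossing:
  "\<exists>A v \<tau>. crossing A v \<tau> \<and> level A v \<tau> > 0 \<and> (\<forall>X w \<sigma>. crossing X w \<sigma> \<longrightarrow> level X w \<sigma> \<le> level A v \<tau>)"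
proof -
  let ?C = "{(A, v, \<tau>). crossing A v \<tau>}" and ?l = "\<lambda>(A, v, \<tau>). level A v \<tau>"
  obtain A v \<tau> where p: "crossing A v \<tau>" "level A v \<tau> > 0" using ex_positive_crossing by blast
  have fin: "finite (?l ` ?C)" using finite_crossings by simp
  have "Max (?l ` ?C) \<in> ?l ` ?C" using fin p by (intro Max_in) auto
  then obtain A' v' \<tau>' where q: "crossing A' v' \<tau>'" "Max (?l ` ?C) = level A' v' \<tau>'" by auto
  have "level X w \<sigma> \<le> level A' v' \<tau>'" if "crossing X w \<sigma>" for X w \<sigma>
    unfolding q(2)[symmetric] using fin that by (intro Max_ge) force+
  with p q show ?thesis by (metis less_le_trans)
qed

end

section \<open>The squares through the farthest crossing\<close>

text \<open>Around the boundary of a square the sign changes an even number of times. As the values at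
  the bottom corners are not 0, the zero found on a vertical side is not on the bottom side.\<close>

lemma square_exit:
  fixes D00 D10 D01 D11 :: real
  assumes "D00 < 0 \<and> D10 > 0 \<or> D00 > 0 \<and> D10 < 0"
  obtains (top) a where "0 \<le> a" "a \<le> 1" "(D01 \<ge> 0) \<noteq> (D11 \<ge> 0)" "(1-a)*D01 + a*D11 = 0"
  | (left) b where "0 < b" "b \<le> 1" "(D00 \<ge> 0) \<noteq> (D01 \<ge> 0)" "(1-b)*D00 + b*D01 = 0"
  | (right) b where "0 < b" "b \<le> 1" "(D10 \<ge> 0) \<noteq> (D11 \<ge> 0)" "(1-b)*D10 + b*D11 = 0"
proof -
  consider "(D01 \<ge> 0) \<noteq> (D11 \<ge> 0)" | "(D00 \<ge> 0) \<noteq> (D01 \<ge> 0)" | "(D10 \<ge> 0) \<noteq> (D11 \<ge> 0)"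
    using assms by linarith
  then show thesis
  proof cases
    case 1
    with sign_change_zero[OF this] top show thesis by blast
  next
    case 2
    with sign_change_zero[OF this] left assms show thesis by auto
  next
    case 3
    with sign_change_zero[OF this] right assms show thesis by auto
  qed
qed

text \<open>On a ray in the positive quadrant both coordinates are smaller at the nearer point. The
  combination of the coordinates with weights \<open>\<bar>\<beta>\<bar>\<close> and \<open>\<bar>\<alpha>\<bar>\<close> is the one that is constant along
  the bottom side of the square; it leaves an inequality with the factor \<open>b\<close>.\<close>

lemma exchange_inequality:
  fixes f g \<alpha> \<beta> x y c a b \<tau> K L :: real
  assumes KL: "K > 0" "L > 0" and sgn: "\<alpha> > 0 \<and> \<beta> > 0 \<or> \<alpha> < 0 \<and> \<beta> < 0" and b: "b > 0"
    and on0: "K*(f + \<tau>*\<alpha>) = L*(g + (1-\<tau>)*\<beta>)"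
    and on1: "K*(f + a*\<alpha> - b*x - a*b*c) = L*(g + (1-a)*\<beta> + b*y + (1-a)*b*c)"
    and le: "f + a*\<alpha> - b*x - a*b*c \<le> f + \<tau>*\<alpha>"
  shows "\<bar>\<alpha>\<bar>*(y + (1-a)*c) \<le> \<bar>\<beta>\<bar>*(x + a*c)"
proof -
  have "L*(g + (1-a)*\<beta> + b*y + (1-a)*b*c) \<le> L*(g + (1-\<tau>)*\<beta>)"
    unfolding on0[symmetric] on1[symmetric] using le KL by simp
  then have le': "g + (1-a)*\<beta> + b*y + (1-a)*b*c \<le> g + (1-\<tau>)*\<beta>" using KL by simp
  have "\<bar>\<beta>\<bar>*(f + a*\<alpha> - b*x - a*b*c) \<le> \<bar>\<beta>\<bar>*(f + \<tau>*\<alpha>)"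
    using le by (intro mult_left_mono) auto
  moreover have "\<bar>\<alpha>\<bar>*(g + (1-a)*\<beta> + b*y + (1-a)*b*c) \<le> \<bar>\<alpha>\<bar>*(g + (1-\<tau>)*\<beta>)"
    using le' by (intro mult_left_mono) auto
  moreover have "\<bar>\<beta>\<bar>*(f + a*\<alpha> - b*x - a*b*c) - \<bar>\<beta>\<bar>*(f + \<tau>*\<alpha>)
      + \<bar>\<alpha>\<bar>*(g + (1-a)*\<beta> + b*y + (1-a)*b*c) - \<bar>\<alpha>\<bar>*(g + (1-\<tau>)*\<beta>)
    = b*(\<bar>\<alpha>\<bar>*(y + (1-a)*c) - \<bar>\<beta>\<bar>*(x + a*c))"
    using sgn by (auto simp: algebra_simps)
  ultimately have "b*(\<bar>\<alpha>\<bar>*(y + (1-a)*c) - \<bar>\<beta>\<bar>*(x + a*c)) \<le> 0" by linarith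
  then show ?thesis using b by (simp add: mult_le_0_iff)
qed

text \<open>A crossing farthest out on the ray, for the edge of the cube from \<open>A\<close> to \<open>A \<union> {v}\<close>.\<close>

locale top_edge = unsplittable V E s t for V :: "'a set" and E s t +
  fixes A :: "'a set" and v :: 'a and \<tau> :: real
  assumes top: "crossing A v \<tau>" and level_pos: "level A v \<tau> > 0"
    and maximal: "crossing X w \<sigma> \<Longrightarrow> level X w \<sigma> \<le> level A v \<tau>"
begin

definition B :: "'a set" where "B = V - insert v A"

definition \<alpha> :: real where "\<alpha> = deg A v - s"
definition \<beta> :: real where "\<beta> = deg B v - t"

lemma A_sub: "A \<subseteq> V" and v_in: "v \<in> V - A" and \<tau>_bounds: "0 \<le> \<tau>" "\<tau> \<le> 1"
  using top by (auto simp: crossing_def)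

lemma parts: "V = insert v (A \<union> B)" "v \<notin> A" "v \<notin> B" "A \<inter> B = {}" "finite A" "finite B"
  using A_sub v_in finite_V finite_subset by (auto simp: B_def)

lemmas edge = along_edge[OF A_sub v_in, folded B_def, folded \<alpha>_def \<beta>_def]

lemma level_eq: "level A v \<tau> = surplus s A + \<tau> * \<alpha>"
  unfolding level_def edge by (simp add: algebra_simps)

lemma on_ray: "(t+1)^2 * (surplus s A + \<tau> * \<alpha>) = (s+1)^2 * (surplus t B + (1-\<tau>) * \<beta>)"
proof -
  have "(1 - \<tau>) * balance A + \<tau> * balance (insert v A) = 0"
    using top by (simp add: crossing_def)
  then show ?thesis unfolding balance_def B_def[symmetric] edge by (simp add: algebra_simps)
qed

lemma nonempty: "A \<noteq> {}" "B \<noteq> {}"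
  and shape: "\<alpha> > 0 \<and> \<beta> > 0 \<and> surplus s A < 0 \<and> surplus t B < 0
        \<and> balance A < 0 \<and> balance (insert v A) > 0
      \<or> \<alpha> < 0 \<and> \<beta> < 0
        \<and> surplus s (insert v A) < 0 \<and> surplus t (V - A) < 0
        \<and> balance A > 0 \<and> balance (insert v A) < 0"
proof -
  have F: "surplus s A + \<tau> * \<alpha> > 0" using level_pos level_eq by simp
  have K: "(t+1)^2 > 0" "(s+1)^2 > 0" using s t by simp_all
  have "(s+1)^2 * (surplus t B + (1-\<tau>) * \<beta>) > 0"
    unfolding on_ray[symmetric] using F K by simp
  then have G: "surplus t B + (1-\<tau>) * \<beta> > 0" using K zero_less_mult_pos by blast
  note * = positive_point_shape[OF A_sub v_in \<tau>_bounds, folded B_def, folded \<alpha>_def \<beta>_def, OF F G]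
  show "A \<noteq> {}" "B \<noteq> {}" by (rule *)+
  show "\<alpha> > 0 \<and> \<beta> > 0 \<and> surplus s A < 0 \<and> surplus t B < 0
        \<and> balance A < 0 \<and> balance (insert v A) > 0
      \<or> \<alpha> < 0 \<and> \<beta> < 0
        \<and> surplus s (insert v A) < 0 \<and> surplus t (V - A) < 0
        \<and> balance A > 0 \<and> balance (insert v A) < 0"
    by (rule *)
qed

text \<open>The square of the cube has the corners \<open>A\<close>, \<open>insert v A\<close>, \<open>X\<close> and \<open>insert v X\<close>, where \<open>X\<close> is
  \<open>A\<close> with one vertex removed or added; \<open>left\<close> and \<open>right\<close> are the maximality of the crossing on
  the two sides of the square that change this vertex. The last two conclusions locate the second
  crossing: a change of sign on one of those two sides is excluded, so the crossing is either on the
  other one or on the edge from \<open>X\<close> to \<open>insert v X\<close>, where linear interpolation gives \<open>a\<close>.\<close>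

lemma exchange:
  fixes x y c :: real
  assumes X: "X \<subseteq> V" "v \<in> V - X"
    and f: "surplus s X = surplus s A - x" "surplus s (insert v X) = surplus s A + \<alpha> - x - c"
    and g: "surplus t (V - X) = surplus t B + \<beta> + y + c" "surplus t (V - insert v X) = surplus t B + y"
    and left: "\<And>b. \<lbrakk>0 < b; b \<le> 1; (balance A \<ge> 0) \<noteq> (balance X \<ge> 0); (1-b) * balance A + b * balance X = 0\<rbrakk>
       \<Longrightarrow> (1-b) * surplus s A + b * surplus s X \<le> level A v \<tau>"
    and right: "\<And>b. \<lbrakk>0 < b; b \<le> 1; (balance (insert v A) \<ge> 0) \<noteq> (balance (insert v X) \<ge> 0);
         (1-b) * balance (insert v A) + b * balance (insert v X) = 0\<rbrakk>
       \<Longrightarrow> (1-b) * surplus s (insert v A) + b * surplus s (insert v X) \<le> level A v \<tau>"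
  obtains a where "0 \<le> a" "a \<le> 1"
    "\<bar>\<alpha>\<bar> * (y + (1-a)*c) \<le> \<bar>\<beta>\<bar> * (x + a*c)"
    "balance (insert v A) > 0 \<Longrightarrow> balance (insert v X) \<ge> 0 \<Longrightarrow>
       a = 0 \<or> (1-a) * ((t+1)^2 * (\<alpha>-c) + (s+1)^2 * (\<beta>+c)) = balance (insert v X)"
    "balance A < 0 \<Longrightarrow> balance X < 0 \<Longrightarrow>
       a = 1 \<or> a * ((t+1)^2 * (\<alpha>-c) + (s+1)^2 * (\<beta>+c)) = - balance X"
proof -
  have K: "(t+1)^2 > 0" "(s+1)^2 > 0" using s t by simp_all
  have signs: "\<alpha> > 0 \<and> \<beta> > 0 \<or> \<alpha> < 0 \<and> \<beta> < 0" using shape by blast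
  have balX: "balance X = (t+1)^2 * (surplus s A - x) - (s+1)^2 * (surplus t B + \<beta> + y + c)"
    "balance (insert v X) = (t+1)^2 * (surplus s A + \<alpha> - x - c) - (s+1)^2 * (surplus t B + y)"
    by (simp_all only: balance_def f g)
  have balA: "balance A = (t+1)^2 * surplus s A - (s+1)^2 * (surplus t B + \<beta>)"
    "balance (insert v A) = (t+1)^2 * (surplus s A + \<alpha>) - (s+1)^2 * surplus t B"
    unfolding balance_def B_def[symmetric] edge by simp_all
  have ineq: "\<bar>\<alpha>\<bar> * (y + (1-a)*c) \<le> \<bar>\<beta>\<bar> * (x + a*c)"
    if "b > 0" "(t+1)^2 * (surplus s A + a*\<alpha> - b*x - a*b*c)
         = (s+1)^2 * (surplus t B + (1-a)*\<beta> + b*y + (1-a)*b*c)"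
      "surplus s A + a*\<alpha> - b*x - a*b*c \<le> level A v \<tau>" for a b
    using exchange_inequality[OF K signs that(1) on_ray that(2)] that(3) level_eq by simp
  have opp: "balance A < 0 \<and> balance (insert v A) > 0 \<or> balance A > 0 \<and> balance (insert v A) < 0"
    using shape by blast
  show thesis
  proof (rule square_exit[OF opp, of "balance X" "balance (insert v X)"])
    fix a assume a: "0 \<le> a" "a \<le> 1" "(balance X \<ge> 0) \<noteq> (balance (insert v X) \<ge> 0)"
      "(1-a) * balance X + a * balance (insert v X) = 0"
    have "crossing X v a" using X a by (simp add: crossing_def)
    from maximal[OF this] have lev: "surplus s A + a*\<alpha> - 1*x - a*1*c \<le> level A v \<tau>"
      unfolding level_def[of X] f by (simp add: algebra_simps)
    have "(t+1)^2 * (surplus s A + a*\<alpha> - 1*x - a*1*c)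
         = (s+1)^2 * (surplus t B + (1-a)*\<beta> + 1*y + (1-a)*1*c)"
      using a(4) unfolding balX by (simp add: algebra_simps)
    from ineq[OF _ this lev] have main: "\<bar>\<alpha>\<bar> * (y + (1-a)*c) \<le> \<bar>\<beta>\<bar> * (x + a*c)" by simp
    have diff: "(t+1)^2 * (\<alpha>-c) + (s+1)^2 * (\<beta>+c) = balance (insert v X) - balance X"
      unfolding balX by (simp add: algebra_simps)
    have "(1-a) * (balance (insert v X) - balance X) = balance (insert v X)"
      "a * (balance (insert v X) - balance X) = - balance X"
      using a(4) by (simp_all add: algebra_simps)
    then show thesis
      by (intro that[OF a(1,2) main]) (simp_all only: diff simp_thms)
  next
    fix b assume b: "0 < b" "b \<le> 1" "(balance A \<ge> 0) \<noteq> (balance X \<ge> 0)"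
      "(1-b) * balance A + b * balance X = 0"
    have lev: "surplus s A + 0*\<alpha> - b*x - 0*b*c \<le> level A v \<tau>"
      using left[OF b] unfolding f by (simp add: algebra_simps)
    have "(t+1)^2 * (surplus s A + 0*\<alpha> - b*x - 0*b*c)
         = (s+1)^2 * (surplus t B + (1-0)*\<beta> + b*y + (1-0)*b*c)"
      using b(4) unfolding balX balA by (simp add: algebra_simps)
    from ineq[OF b(1) this lev] have main: "\<bar>\<alpha>\<bar> * (y + (1-0)*c) \<le> \<bar>\<beta>\<bar> * (x + 0*c)" .
    show thesis
      by (rule that[of 0]) (use main b(3) in auto)
  next
    fix b assume b: "0 < b" "b \<le> 1" "(balance (insert v A) \<ge> 0) \<noteq> (balance (insert v X) \<ge> 0)"
      "(1-b) * balance (insert v A) + b * balance (insert v X) = 0"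
    have lev: "surplus s A + 1*\<alpha> - b*x - 1*b*c \<le> level A v \<tau>"
      using right[OF b] unfolding f edge by (simp add: algebra_simps)
    have "(t+1)^2 * (surplus s A + 1*\<alpha> - b*x - 1*b*c)
         = (s+1)^2 * (surplus t B + (1-1)*\<beta> + b*y + (1-1)*b*c)"
      using b(4) unfolding balX balA by (simp add: algebra_simps)
    from ineq[OF b(1) this lev] have main: "\<bar>\<alpha>\<bar> * (y + (1-1)*c) \<le> \<bar>\<beta>\<bar> * (x + 1*c)" .
    show thesis
      by (rule that[of 1]) (use main b(3) in auto)
  qed
qed

text \<open>In the last part the corner \<open>insert v A - {z}\<close> has nonnegative surplus, so that its complement
  has negative surplus and the corner lies on the positive side, like \<open>insert v A\<close>.\<close>

lemma remove_from_A:
  assumes z: "z \<in> A"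
  obtains a where "0 \<le> a" "a \<le> 1"
    "\<bar>\<alpha>\<bar> * (deg B z - t + (1-a) * adj v z) \<le> \<bar>\<beta>\<bar> * (deg A z - s + a * adj v z)"
    "\<lbrakk>\<alpha> > 0; adj v z = 1; surplus s A + \<alpha> - deg A z + s - 1 \<ge> 0\<rbrakk> \<Longrightarrow>
       a = 0 \<or> (t+1)^2 * (surplus s A + \<alpha> - deg A z + s - 1)
          \<le> (1-a) * ((t+1)^2 * (\<alpha>-1) + (s+1)^2 * (\<beta>+1))"
proof -
  let ?X = "A - {z}"
  have zX: "z \<notin> ?X" "z \<noteq> v" "z \<in> V" "z \<notin> B" "insert z ?X = A" using z parts A_sub by auto
  have fX: "finite ?X" using parts by simp
  have degz: "deg ?X z = deg A z" and degv: "deg ?X v = deg A v - adj v z"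
    using deg_insert[OF fX zX(1), of z] deg_insert[OF fX zX(1), of v] zX by (simp_all add: adj_commute)
  have f1: "surplus s ?X = surplus s A - (deg A z - s)"
    using surplus_insert[OF fX zX(1), of s] zX degz by simp
  have f2: "surplus s (insert v ?X) = surplus s A + \<alpha> - (deg A z - s) - adj v z"
    using surplus_insert[OF fX, of v s] parts f1 degv by (simp add: \<alpha>_def)
  have V1: "V - insert v ?X = insert z B" and V2: "V - ?X = insert z (insert v B)"
    using parts z by (auto simp: B_def)
  have g1: "surplus t (V - insert v ?X) = surplus t B + (deg B z - t)"
    unfolding V1 using parts zX by (simp add: surplus_insert)
  have g2: "surplus t (V - ?X) = surplus t B + \<beta> + (deg B z - t) + adj v z"
    unfolding V2 using parts zX by (simp add: surplus_insert deg_insert \<beta>_def)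
  have X: "?X \<subseteq> V" "v \<in> V - ?X" using A_sub v_in by auto
  obtain a where a: "0 \<le> a" "a \<le> 1"
    "\<bar>\<alpha>\<bar> * (deg B z - t + (1-a)*adj v z) \<le> \<bar>\<beta>\<bar> * (deg A z - s + a*adj v z)"
    "balance (insert v A) > 0 \<Longrightarrow> balance (insert v ?X) \<ge> 0 \<Longrightarrow>
       a = 0 \<or> (1-a) * ((t+1)^2 * (\<alpha>-adj v z) + (s+1)^2 * (\<beta>+adj v z)) = balance (insert v ?X)"
  proof (rule exchange[OF X f1 f2 g2 g1])
    fix b assume b: "0 < b" "b \<le> 1" "(balance A \<ge> 0) \<noteq> (balance ?X \<ge> 0)"
      "(1-b) * balance A + b * balance ?X = 0"
    (* this edge of the cube is run through from A - {z} to A, against the parameter b *)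
    have "crossing ?X z (1-b)" using X zX b by (auto simp: crossing_def insert_absorb z)
    from maximal[OF this] show "(1-b) * surplus s A + b * surplus s ?X \<le> level A v \<tau>"
      unfolding level_def[of ?X] zX by simp
  next
    fix b assume b: "0 < b" "b \<le> 1" "(balance (insert v A) \<ge> 0) \<noteq> (balance (insert v ?X) \<ge> 0)"
      "(1-b) * balance (insert v A) + b * balance (insert v ?X) = 0"
    have ins: "insert z (insert v ?X) = insert v A" using z by auto
    have "crossing (insert v ?X) z (1-b)" using X zX b v_in unfolding crossing_def ins by auto
    from maximal[OF this] show "(1-b) * surplus s (insert v A) + b * surplus s (insert v ?X) \<le> level A v \<tau>"
      unfolding level_def[of "insert v ?X"] ins by simp
  qed blast
  show thesis
  proof (rule that[OF a(1-3)])
    assume h: "\<alpha> > 0" "adj v z = 1" "surplus s A + \<alpha> - deg A z + s - 1 \<ge> 0"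
    have f2': "surplus s (insert v ?X) = surplus s A + \<alpha> - deg A z + s - 1"
      using f2 h(2) by simp
    have "insert v ?X \<noteq> V" using zX by auto
    then have g_neg: "surplus t (V - insert v ?X) < 0"
      using unsplit[of "insert v ?X"] X v_in h(3) f2' by auto
    have "(s+1)^2 * surplus t (V - insert v ?X) \<le> 0" using g_neg by (simp add: mult_nonneg_nonpos)
    then have ge: "(t+1)^2 * (surplus s A + \<alpha> - deg A z + s - 1) \<le> balance (insert v ?X)"
      unfolding balance_def f2' by simp
    moreover have "0 \<le> (t+1)^2 * (surplus s A + \<alpha> - deg A z + s - 1)" using h(3) by simp
    moreover have "balance (insert v A) > 0" using shape h(1) by auto
    ultimately show "a = 0 \<or> (t+1)^2 * (surplus s A + \<alpha> - deg A z + s - 1)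
          \<le> (1-a) * ((t+1)^2 * (\<alpha>-1) + (s+1)^2 * (\<beta>+1))"
      using a(4) h(2) by auto
  qed
qed

text \<open>This mirrors the case of \<open>A\<close>, with \<open>z\<close> moving in the opposite direction, so that \<open>exchange\<close>
  is applied with all signs reversed.\<close>

lemma remove_from_B:
  assumes z: "z \<in> B"
  obtains a where "0 \<le> a" "a \<le> 1"
    "\<bar>\<beta>\<bar> * (deg A z - s + a * adj v z) \<le> \<bar>\<alpha>\<bar> * (deg B z - t + (1-a) * adj v z)"
    "\<lbrakk>\<alpha> > 0; adj v z = 1; surplus t B + \<beta> - deg B z + t - 1 \<ge> 0\<rbrakk> \<Longrightarrow>
       a = 1 \<or> (s+1)^2 * (surplus t B + \<beta> - deg B z + t - 1)
          \<le> a * ((s+1)^2 * (\<beta>-1) + (t+1)^2 * (\<alpha>+1))"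
proof -
  let ?X = "insert z A" and ?Y = "B - {z}"
  have zX: "z \<notin> ?Y" "z \<noteq> v" "z \<in> V" "z \<notin> A" "insert z ?Y = B" using z parts by auto
  have fY: "finite ?Y" using parts by simp
  have degz: "deg ?Y z = deg B z" and degv: "deg ?Y v = deg B v - adj v z"
    using deg_insert[OF fY zX(1), of z] deg_insert[OF fY zX(1), of v] zX by (simp_all add: adj_commute)
  have g0: "surplus t ?Y = surplus t B - (deg B z - t)"
    using surplus_insert[OF fY zX(1), of t] zX degz by simp
  have V1: "V - insert v ?X = ?Y" and V2: "V - ?X = insert v ?Y"
    using parts z by (auto simp: B_def)
  have g1: "surplus t (V - insert v ?X) = surplus t B + - (deg B z - t)"
    unfolding V1 using g0 by simp
  have g2: "surplus t (V - ?X) = surplus t B + \<beta> + - (deg B z - t) + - adj v z"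
    unfolding V2 using surplus_insert[OF fY, of v t] parts g0 degv by (simp add: \<beta>_def)
  have f1: "surplus s ?X = surplus s A - - (deg A z - s)"
    using parts zX by (simp add: surplus_insert)
  have f2: "surplus s (insert v ?X) = surplus s A + \<alpha> - - (deg A z - s) - - adj v z"
    using parts zX by (simp add: surplus_insert deg_insert \<alpha>_def adj_commute)
  have X: "?X \<subseteq> V" "v \<in> V - ?X" using A_sub v_in zX by auto
  obtain a where a: "0 \<le> a" "a \<le> 1"
    "\<bar>\<alpha>\<bar> * (- (deg B z - t) + (1-a)*(- adj v z)) \<le> \<bar>\<beta>\<bar> * (- (deg A z - s) + a*(- adj v z))"
    "balance A < 0 \<Longrightarrow> balance ?X < 0 \<Longrightarrow>
       a = 1 \<or> a * ((t+1)^2 * (\<alpha> - - adj v z) + (s+1)^2 * (\<beta> + - adj v z)) = - balance ?X"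
  proof (rule exchange[OF X f1 f2 g2 g1])
    fix b assume b: "0 < b" "b \<le> 1" "(balance A \<ge> 0) \<noteq> (balance ?X \<ge> 0)"
      "(1-b) * balance A + b * balance ?X = 0"
    have "crossing A z b" using A_sub zX b by (auto simp: crossing_def)
    from maximal[OF this] show "(1-b) * surplus s A + b * surplus s ?X \<le> level A v \<tau>"
      by (simp add: level_def[of A z])
  next
    fix b assume b: "0 < b" "b \<le> 1" "(balance (insert v A) \<ge> 0) \<noteq> (balance (insert v ?X) \<ge> 0)"
      "(1-b) * balance (insert v A) + b * balance (insert v ?X) = 0"
    have ins: "insert z (insert v A) = insert v ?X" by auto
    have "crossing (insert v A) z b" using A_sub zX b v_in unfolding crossing_def ins by auto
    from maximal[OF this] show "(1-b) * surplus s (insert v A) + b * surplus s (insert v ?X) \<le> level A v \<tau>"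
      by (simp only: level_def[of "insert v A"] ins)
  qed blast
  show thesis
  proof (rule that[OF a(1,2)])
    show "\<bar>\<beta>\<bar> * (deg A z - s + a * adj v z) \<le> \<bar>\<alpha>\<bar> * (deg B z - t + (1-a) * adj v z)"
      using a(3) by (simp add: algebra_simps)
    assume h: "\<alpha> > 0" "adj v z = 1" "surplus t B + \<beta> - deg B z + t - 1 \<ge> 0"
    have g2': "surplus t (V - ?X) = surplus t B + \<beta> - deg B z + t - 1"
      using g2 h(2) by simp
    have "?X \<noteq> V" using X by auto
    then have f_neg: "surplus s ?X < 0"
      using unsplit[of ?X] X h(3) g2' by auto
    then have neg: "(t+1)^2 * surplus s ?X < 0" using t by (simp add: mult_pos_neg)
    then have ge: "(s+1)^2 * (surplus t B + \<beta> - deg B z + t - 1) \<le> - balance ?X"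
      unfolding balance_def g2' by simp
    moreover have "0 \<le> (s+1)^2 * (surplus t B + \<beta> - deg B z + t - 1)" using h(3) by simp
    then have "balance ?X < 0" unfolding balance_def g2' using neg by simp
    moreover have "balance A < 0" using shape h(1) by auto
    ultimately show "a = 1 \<or> (s+1)^2 * (surplus t B + \<beta> - deg B z + t - 1)
          \<le> a * ((s+1)^2 * (\<beta>-1) + (t+1)^2 * (\<alpha>+1))"
      using a(4) h(2) by (auto simp: algebra_simps)
  qed
qed

end

section \<open>Summing the exchange inequalities\<close>

context finite_simple_graph begin

text \<open>Summation over \<open>X\<close> turns the degrees into numbers of edges. The inequalities for \<open>A\<close> and for \<open>B\<close>
  both have this form, with \<open>1 - a\<close> in place of \<open>a\<close> for \<open>B\<close>.\<close>

lemma exchange_sum: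
  assumes "finite X"
    and "\<And>z. z \<in> X \<Longrightarrow> w * (deg Y z - t + (1 - a z) * adj v z) \<le> u * (deg X z - s + a z * adj v z)"
  defines "C \<equiv> \<Sum>z\<in>X. (1 - a z) * adj v z"
  shows "w * ((\<Sum>z\<in>X. deg Y z) - t * real (card X) + C)
    \<le> u * (2 * real (num_edges E X) - s * real (card X) + deg X v - C)"
proof -
  have C: "deg X v - C = (\<Sum>z\<in>X. a z * adj v z)"
    unfolding C_def deg_def sum_subtractf[symmetric] by (intro sum.cong refl) (simp add: adj_commute algebra_simps)
  have "(\<Sum>z\<in>X. w * (deg Y z - t + (1 - a z) * adj v z)) \<le> (\<Sum>z\<in>X. u * (deg X z - s + a z * adj v z))"
    using assms(2) by (intro sum_mono)
  moreover have "(\<Sum>z\<in>X. w * (deg Y z - t + (1 - a z) * adj v z))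
      = w * ((\<Sum>z\<in>X. deg Y z) - t * real (card X) + C)"
    by (simp add: sum_distrib_left[symmetric] sum.distrib sum_subtractf C_def mult.commute)
  moreover have "(\<Sum>z\<in>X. u * (deg X z - s + a z * adj v z))
      = u * (2 * real (num_edges E X) - s * real (card X) + (deg X v - C))"
    unfolding C sum_deg[OF assms(1), symmetric]
    by (simp add: sum_distrib_left[symmetric] sum.distrib sum_subtractf mult.commute)
  ultimately show ?thesis by (simp add: algebra_simps)
qed

text \<open>A neighbour \<open>z\<close> of \<open>v\<close> whose value \<open>deg X v - 1 - \<phi> - deg X z\<close> is negative only helps. For
  the others \<open>step\<close> applies, and the conditions on \<open>x\<close> are those under which \<open>x\<close> times that
  value is at most \<open>1 - a z\<close> in both of its cases. Summing over the neighbours, the degrees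
  \<open>deg X z\<close> add up to no more than twice the number of edges.\<close>

lemma neighbour_sum:
  fixes x N K \<phi> :: real
  assumes fin: "finite X" and a: "\<And>z. z \<in> X \<Longrightarrow> a z \<le> 1"
    and x: "x \<ge> 0" "x * deg X v \<le> 1" "x * N \<le> K" and N: "N > 0" and \<phi>: "\<phi> \<ge> 0"
    and step: "\<And>z. \<lbrakk>z \<in> X; adj v z = 1; deg X v - 1 - \<phi> - deg X z \<ge> 0\<rbrakk> \<Longrightarrow>
      a z = 0 \<or> K * (deg X v - 1 - \<phi> - deg X z) \<le> (1 - a z) * N"
  shows "x * (deg X v * (deg X v - 1 - \<phi>) - 2 * real (num_edges E X))
    \<le> (\<Sum>z\<in>X. (1 - a z) * adj v z)"
proof -
  have pointwise: "x * (adj v z * (deg X v - 1 - \<phi>) - deg X z) \<le> (1 - a z) * adj v z"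
    if z: "z \<in> X" for z
  proof (cases "adj v z = 1")
    case False
    then have "adj v z = 0" using adj_01 by blast
    then show ?thesis using x by simp
  next
    case adj: True
    let ?d = "deg X v - 1 - \<phi> - deg X z"
    have "x * ?d \<le> 1 - a z"
    proof (cases "?d \<ge> 0")
      case False
      then have "x * ?d \<le> 0" using x by (intro mult_nonneg_nonpos) auto
      with a[OF z] show ?thesis by simp
    next
      case True
      from step[OF z adj True] show ?thesis
      proof
        assume "a z = 0"
        moreover have "x * ?d \<le> x * deg X v"
          using x(1) \<phi> deg_nonneg[of X z] by (intro mult_left_mono) linarith+
        ultimately show ?thesis using x(2) by simp
      next
        assume "K * ?d \<le> (1 - a z) * N"
        moreover have "(x * N) * ?d \<le> K * ?d" using x(3) True by (rule mult_right_mono)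
        ultimately have "(x * ?d) * N \<le> (1 - a z) * N" by (simp add: algebra_simps)
        then show ?thesis using N by simp
      qed
    qed
    then show ?thesis using adj by (simp add: algebra_simps)
  qed
  have "(\<Sum>z\<in>X. x * (adj v z * (deg X v - 1 - \<phi>) - deg X z)) \<le> (\<Sum>z\<in>X. (1 - a z) * adj v z)"
    using pointwise by (rule sum_mono)
  moreover have "(\<Sum>z\<in>X. x * (adj v z * (deg X v - 1 - \<phi>) - deg X z))
     = x * (deg X v * (deg X v - 1 - \<phi>) - 2 * real (num_edges E X))"
    unfolding sum_deg[OF fin, symmetric]
    by (simp add: sum_distrib_left[symmetric] sum_distrib_right[symmetric] sum_subtractf deg_def adj_commute)
  ultimately show ?thesis by simp
qed

end

section \<open>The arithmetic of the summed inequalities\<close>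

text \<open>For positive \<open>a\<close> and \<open>b\<close> the left side is nonnegative exactly if the factor \<open>a / ((a+b) (b+t))\<close> is admissible for the
  second correction term. Its leading part \<open>(s+1)\<^sup>2 b\<^sup>2 - (t+1)\<^sup>2 a\<^sup>2\<close> vanishes with \<open>d\<close> because the
  ray has the slope \<open>(t+1)\<^sup>2 / (s+1)\<^sup>2\<close>.\<close>

lemma slack_identity:
  fixes s t a b :: real
  defines "d \<equiv> (s+1)*b - (t+1)*a"
  shows "(a+b) * (s+1)^2 * (b+t) - a * ((s+1)^2*(b-1) + (t+1)^2*(a+1))
       = 2*(t+1)*a*d + d^2 + t*(s+1)*d + s*(t+1)*a*(s+t+2)"
  unfolding d_def by algebra

text \<open>Equality holds for \<open>eA = b / ((a+b) (a+s))\<close> and \<open>eB = a / ((a+b) (b+t))\<close>. The second value is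
  admissible by \<open>slack_identity\<close>. If the first is too large, both factors are taken as large as
  they may be; the excess of the second over its balanced value, which is governed by the slack
  \<open>W\<close>, then makes up for the deficit of the first. If \<open>a < s+1\<close>, the first factor has a
  nonpositive gain and is 0, and likewise the second if \<open>b < t+1\<close>.\<close>

lemma multipliers_ordered:
  fixes s t a b :: real
  assumes s: "s > 0" and t: "t > 0" and a: "a > 0" and b: "b > 0"
    and ord: "(t+1)*a \<le> (s+1)*b"
  shows "\<exists>eA eB. eA \<ge> 0 \<and> eB \<ge> 0
    \<and> (eA = 0 \<or> a \<ge> s+1 \<and> eA*(a+s) \<le> 1 \<and> eA*((t+1)^2*(a-1) + (s+1)^2*(b+1)) \<le> (t+1)^2)
    \<and> (eB = 0 \<or> b \<ge> t+1 \<and> eB*(b+t) \<le> 1 \<and> eB*((s+1)^2*(b-1) + (t+1)^2*(a+1)) \<le> (s+1)^2)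
    \<and> (s+1)*a*(b-(t+1)) + (t+1)*b*(a-(s+1))
        \<le> (a+b) * ((t+1)*eA*(a+s)*(a-(s+1)) + (s+1)*eB*(b+t)*(b-(t+1)))"
proof -
  define S T where "S = s+1" and "T = t+1"
  define d where "d = S*b - T*a"
  define W where "W = 2*T*a*d + d^2 + t*S*d + s*T*a*(S+T)"
  define p q where "p = a+s" and "q = b+t"
  define N1 N2 where "N1 = T^2*(a-1) + S^2*(b+1)" and "N2 = S^2*(b-1) + T^2*(a+1)"
  have S1: "S > 1" and T1: "T > 1" and d0: "d \<ge> 0" and pq: "p > 0" "q > 0"
    using s t a b ord by (auto simp: S_def T_def d_def p_def q_def)
  have Weq: "(a+b)*S^2*q - a*N2 = W"
    using slack_identity[of a b s t]
    by (simp add: W_def N2_def S_def T_def d_def q_def algebra_simps)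
  have W0: "W \<ge> 0"
    unfolding W_def using d0 S1 T1 a s t by simp
  have ab: "a+b > 0" using a b by simp
  let ?P = "\<lambda>eA eB. eA \<ge> 0 \<and> eB \<ge> 0
    \<and> (eA = 0 \<or> a \<ge> S \<and> eA*p \<le> 1 \<and> eA*N1 \<le> T^2)
    \<and> (eB = 0 \<or> b \<ge> T \<and> eB*q \<le> 1 \<and> eB*N2 \<le> S^2)
    \<and> S*a*(b-T) + T*b*(a-S) \<le> (a+b) * (T*eA*p*(a-S) + S*eB*q*(b-T))"
  define e0 where "e0 = a/((a+b)*q)"
  have e0: "e0 \<ge> 0" "e0*q \<le> 1" "e0*N2 \<le> S^2" "(a+b)*(e0*q) = a"
  proof -
    show "e0 \<ge> 0" using a ab pq by (simp add: e0_def)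
    show "e0*q \<le> 1" using a b pq by (simp add: e0_def)
    show "(a+b)*(e0*q) = a" using ab pq by (simp add: e0_def)
    have "a*N2 \<le> S^2*((a+b)*q)" using Weq W0 by (simp add: algebra_simps)
    then show "e0*N2 \<le> S^2"
      using ab pq by (simp add: e0_def divide_le_eq)
  qed
  have "\<exists>eA eB. ?P eA eB"
  proof (cases "a < S")
    case True
    show ?thesis
    proof (cases "b < T")
      case True
      have "S*a*(b-T) \<le> 0" "T*b*(a-S) \<le> 0"
        using \<open>a < S\<close> True S1 T1 a b by (auto intro!: mult_nonneg_nonpos)
      then have "?P 0 0" by simp
      then show ?thesis by blast
    next
      case False
      have neg: "T*b*(a-S) \<le> 0"
        using \<open>a < S\<close> S1 T1 a b by (auto intro!: mult_nonneg_nonpos)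
      have eq: "(a+b) * (S*e0*q*(b-T)) = S*a*(b-T)"
      proof -
        have "(a+b) * (S*e0*q*(b-T)) = S*(b-T)*((a+b)*(e0*q))" by (simp add: algebra_simps)
        then show ?thesis unfolding e0(4) by (simp add: algebra_simps)
      qed
      have "S*a*(b-T) + T*b*(a-S) \<le> (a+b) * (T*0*p*(a-S) + S*e0*q*(b-T))"
        using neg eq by (simp only: mult_zero_right mult_zero_left add_0_left)
      then have "?P 0 e0" using e0(1-3) False by simp
      then show ?thesis by blast
    qed
  next
    case False
    then have aS: "a \<ge> S" by simp
    have "S*b \<ge> S*T" using ord aS T1 mult_left_mono[OF aS, of T] by (simp add: S_def T_def algebra_simps)
    then have bT: "b \<ge> T" using S1 by simp
    have N1: "N1 > 0" unfolding N1_def using aS bT S1 T1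
      by (intro add_pos_pos mult_pos_pos) auto
    have N2: "N2 > 0" unfolding N2_def using aS bT S1 T1
      by (intro add_pos_pos mult_pos_pos) auto
    define eA where "eA = b/((a+b)*p)"
    show ?thesis
    proof (cases "eA*N1 \<le> T^2")
      case True
      have eA: "eA*p \<le> 1" "eA \<ge> 0" "(a+b)*(eA*p) = b"
        using a b ab pq by (simp_all add: eA_def)
      have eq: "(a+b)*(T*eA*p*(a-S) + S*e0*q*(b-T)) = S*a*(b-T) + T*b*(a-S)"
      proof -
        have "(a+b)*(T*eA*p*(a-S) + S*e0*q*(b-T))
            = T*(a-S)*((a+b)*(eA*p)) + S*(b-T)*((a+b)*(e0*q))" by (simp add: algebra_simps)
        then show ?thesis unfolding e0(4) eA(3) by (simp add: algebra_simps)
      qed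
      then have "S*a*(b-T) + T*b*(a-S) \<le> (a+b) * (T*eA*p*(a-S) + S*e0*q*(b-T))" by simp
      then have "?P eA e0" using e0(1-3) eA(1,2) aS bT True by blast
      then show ?thesis by blast
    next
      case False
      define fA where "fA = T^2/N1"
      have fA0: "fA \<ge> 0" "fA*N1 = T^2" using N1 by (simp_all add: fA_def)
      have "fA \<le> eA" using False N1 by (simp add: fA_def divide_le_eq)
      then have "fA*p \<le> eA*p" using pq by simp
      also have "\<dots> \<le> 1" using a b pq by (simp add: eA_def)
      finally have fAp: "fA*p \<le> 1" .
      have fge: "T*fA*p*(a-S) \<ge> 0" using T1 fA0 pq aS by simp
      show ?thesis
      proof (cases "N2 \<le> S^2*q")
        case True
        have "(1/q)*N2 \<le> S^2" using True pq by (simp add: divide_le_eq)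
        moreover have "S*a*(b-T) + T*b*(a-S) \<le> (a+b) * (T*fA*p*(a-S) + S*(1/q)*q*(b-T))"
        proof -
          have "b*(T*(a-S)) \<le> b*(S*(b-T))"
            using d0 b by (intro mult_left_mono) (auto simp: d_def algebra_simps)
          then have "S*a*(b-T) + T*b*(a-S) \<le> (a+b)*(S*(b-T))" by (simp add: algebra_simps)
          also have "\<dots> \<le> (a+b) * (T*fA*p*(a-S) + S*(1/q)*q*(b-T))"
            using ab fge pq by (intro mult_left_mono) auto
          finally show ?thesis .
        qed
        ultimately have "?P fA (1/q)" using fA0 fAp aS bT pq by (intro conjI) auto
        then show ?thesis by blast
      next
        case False
        (* both factors at their upper bounds; S*(b-T) is a1 + d, and num / (N1*N2) is the
           amount by which fA*p + fB*q exceeds 1 *)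
        define fB where "fB = S^2/N2"
        have fB0: "fB \<ge> 0" "fB*N2 = S^2" using N2 by (simp_all add: fB_def)
        have fBq: "fB*q \<le> 1" using False N2 by (simp add: fB_def divide_le_eq)
        define a1 where "a1 = T*(a-S)"
        define num where "num = T^2*p*N2 + S^2*q*N1 - N1*N2"
        define lam where "lam = s*T^2 + t*S^2"
        have a1: "a1 \<ge> 0" using aS T1 by (simp add: a1_def)
        have key: "a1*(a+b)*num + d*W*N1 \<ge> 0"
        proof (cases "num \<ge> 0")
          case True
          then show ?thesis using a1 ab d0 W0 N1 by simp
        next
          case False
          define om where "om = (1-s)*T - S^2"
          have numeq: "num = T*a*(S+T)*lam + (S+T)*(S-T)^2*T*(a+S) - S*d*T*om"
            unfolding num_def lam_def p_def q_def N1_def N2_def d_def om_def S_def T_def by algebra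
          have "(S+T)*(S-T)^2*T*(a+S) \<ge> 0" using S1 T1 a by simp
          with numeq have num1: "num \<ge> T*a*(S+T)*lam - S*d*T*om" by simp
          have lam0: "lam \<ge> t*S^2" using s by (simp add: lam_def)
          have lam1: "lam > 0" using s t S1 T1 by (simp add: lam_def add_pos_pos)
          have "T*a*(S+T)*lam \<ge> 0" using S1 T1 a lam1 by simp
          with num1 have num2: "num \<ge> - (S*d*T*om)" by simp
          with False have "S*d*T*om > 0" by simp
          moreover have "S*d*T \<ge> 0" using S1 T1 d0 by simp
          ultimately have om0: "om > 0"
            using mult_nonneg_nonpos[of "S*d*T" om] by linarith
          have "t*S - om = (S-1)*(2*T+S)"
            unfolding om_def S_def T_def by algebra
          moreover have "(S-1)*(2*T+S) \<ge> 0" using S1 T1 by simp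
          ultimately have tS: "om \<le> t*S" by simp
          have omT: "om \<le> T" using s T1 by (simp add: om_def algebra_simps add_nonneg_nonneg)
          have lamS: "S*om \<le> lam"
          proof -
            have "S*om \<le> S*(t*S)" using tS S1 by simp
            then show ?thesis using lam0 by (simp add: power2_eq_square algebra_simps)
          qed
          (* num < 0 requires d to be large, which makes the slack W large *)
          have dbig: "d \<ge> a*(S+T)"
          proof (rule ccontr)
            assume "\<not> ?thesis"
            then have "d \<le> a*(S+T)" by simp
            then have "d*(S*om) \<le> a*(S+T)*lam"
              using lamS d0 om0 S1 T1 a by (intro mult_mono) auto
            then have "T*(d*(S*om)) \<le> T*(a*(S+T)*lam)" using T1 by simp
            then show False using num1 False by (simp add: algebra_simps)
          qed
          have "1*(S+T) \<le> a*(S+T)" using aS S1 T1 by (intro mult_right_mono) auto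
          with dbig have dST: "S+T \<le> d" by simp
          have "om*(a*(S+T)+d) \<le> W"
          proof -
            have "om*(a*(S+T)) \<le> T*(a*d)"
              using omT dST a T1 S1 om0 by (intro mult_mono) auto
            moreover have "om*d \<le> t*S*d" using tS d0 by (intro mult_right_mono)
            moreover have "T*(a*d) \<ge> 0" "d^2 \<ge> 0" "s*T*a*(S+T) \<ge> 0"
              using T1 a d0 s S1 by simp_all
            moreover have "W - om*(a*(S+T)+d) = (T*(a*d) - om*(a*(S+T))) + (t*S*d - om*d)
                + T*(a*d) + d^2 + s*T*a*(S+T)"
              by (simp add: W_def algebra_simps)
            ultimately show ?thesis by linarith
          qed
          then have h1: "d*N1*(om*(a*(S+T)+d)) \<le> d*N1*W" using d0 N1 by (intro mult_left_mono) auto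
          have Ta1: "T*a1 \<le> N1"
          proof -
            have "T^2*(a-S) \<le> T^2*(a-1)" using S1 by (intro mult_left_mono) auto
            moreover have "S^2*(b+1) \<ge> 0" using b by simp
            ultimately show ?thesis unfolding a1_def N1_def by (simp add: power2_eq_square algebra_simps)
          qed
          have "(T*a1)*(d*(om*(a*(S+T)+d))) \<le> N1*(d*(om*(a*(S+T)+d)))"
            using Ta1 d0 om0 a S1 T1 by (intro mult_right_mono) auto
          moreover have "(T*a1)*(d*(om*(a*(S+T)+d))) = a1*(a+b)*(S*d*T*om)"
            unfolding d_def by algebra
          ultimately have "a1*(a+b)*(S*d*T*om) \<le> d*W*N1" using h1 by (simp add: algebra_simps)
          moreover have "a1*(a+b)*(-(S*d*T*om)) \<le> a1*(a+b)*num"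
            using num2 a1 ab by (intro mult_left_mono) auto
          ultimately show ?thesis by simp
        qed
        have "0 \<le> (a1*(a+b)*num + d*W*N1) / (N1*N2)" using key N1 N2 by simp
        also have eq: "\<dots> = (a+b) * (T*fA*p*(a-S) + S*fB*q*(b-T)) - (S*a*(b-T) + T*b*(a-S))"
        proof -
          have "N1*N2*((a+b) * (T*fA*p*(a-S) + S*fB*q*(b-T)) - (S*a*(b-T) + T*b*(a-S)))
              = a1*(a+b)*num + d*W*N1"
            unfolding num_def a1_def using fA0(2) fB0(2) Weq d_def by algebra
          then show ?thesis using N1 N2 by (simp add: divide_eq_eq field_simps)
        qed
        finally have "S*a*(b-T) + T*b*(a-S) \<le> (a+b) * (T*fA*p*(a-S) + S*fB*q*(b-T))" by simp
        then have "?P fA fB" using fA0 fB0 fAp fBq aS bT by simp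
        then show ?thesis by blast
      qed
    qed
  qed
  then show ?thesis unfolding S_def T_def p_def q_def N1_def N2_def .
qed

lemma multipliers:
  fixes s t a b :: real
  assumes "s > 0" and "t > 0" and "a > 0" and "b > 0"
  shows "\<exists>eA eB. eA \<ge> 0 \<and> eB \<ge> 0
    \<and> (eA = 0 \<or> a \<ge> s+1 \<and> eA*(a+s) \<le> 1 \<and> eA*((t+1)^2*(a-1) + (s+1)^2*(b+1)) \<le> (t+1)^2)
    \<and> (eB = 0 \<or> b \<ge> t+1 \<and> eB*(b+t) \<le> 1 \<and> eB*((s+1)^2*(b-1) + (t+1)^2*(a+1)) \<le> (s+1)^2)
    \<and> (s+1)*a*(b-(t+1)) + (t+1)*b*(a-(s+1))
        \<le> (a+b) * ((t+1)*eA*(a+s)*(a-(s+1)) + (s+1)*eB*(b+t)*(b-(t+1)))"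
proof (cases "(t+1)*a \<le> (s+1)*b")
  case True
  then show ?thesis using multipliers_ordered assms by blast
next
  case False
  then have "(s+1)*b \<le> (t+1)*a" by simp
  from multipliers_ordered[OF assms(2,1,4,3) this] obtain eA eB where
    "eA \<ge> 0 \<and> eB \<ge> 0
    \<and> (eB = 0 \<or> b \<ge> t+1 \<and> eB*(b+t) \<le> 1 \<and> eB*((s+1)^2*(b-1) + (t+1)^2*(a+1)) \<le> (s+1)^2)
    \<and> (eA = 0 \<or> a \<ge> s+1 \<and> eA*(a+s) \<le> 1 \<and> eA*((t+1)^2*(a-1) + (s+1)^2*(b+1)) \<le> (t+1)^2)
    \<and> (t+1)*b*(a-(s+1)) + (s+1)*a*(b-(t+1))
        \<le> (b+a) * ((s+1)*eB*(b+t)*(b-(t+1)) + (t+1)*eA*(a+s)*(a-(s+1)))"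
    by blast
  then show ?thesis by (metis add.commute)
qed

text \<open>Here \<open>a\<close> and \<open>b\<close> are the amounts by which \<open>v\<close> changes the surplus of \<open>A\<close> and of \<open>B\<close>, \<open>m\<close> and
  \<open>k\<close> the sizes of \<open>A\<close> and \<open>B\<close>, and \<open>e\<close> the number of edges between them. Adding \<open>t+1\<close> times
  \<open>sumA\<close> to \<open>s+1\<close> times \<open>sumB\<close> and eliminating \<open>e\<close> leaves the inequality refuted by
  \<open>multipliers\<close>, up to terms in the deficits \<open>s m - P\<close>, \<open>t k - Q\<close> and in the numbers
  \<open>m - (a+s)\<close>, \<open>k - (b+t)\<close> of non-neighbours, all of which have favourable signs.\<close>

lemma increasing_edge_contradiction:
  fixes s t a b m k P Q e CA CB :: real
  assumes s: "s > 0" and t: "t > 0" and a: "a > 0" and b: "b > 0"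
    and fA: "P < s*m" and gB: "Q < t*k" and m: "a+s \<le> m" and k: "b+t \<le> k"
    and e: "(s+t+1)*(m+k+1) \<le> P+Q+(a+s)+(b+t)+e"
    and sumA: "a*(e - t*m + CA) \<le> b*(2*P - s*m + (a+s) - CA)"
    and sumB: "b*(e - s*k + CB) \<le> a*(2*Q - t*k + (b+t) - CB)"
    and CA: "\<And>x. \<lbrakk>x \<ge> 0; x = 0 \<or> a \<ge> s+1 \<and> x*(a+s) \<le> 1
              \<and> x*((t+1)^2*(a-1) + (s+1)^2*(b+1)) \<le> (t+1)^2\<rbrakk>
            \<Longrightarrow> x*((a+s)*(a+s-1-(s*m-P)) - 2*P) \<le> CA"
    and CB: "\<And>x. \<lbrakk>x \<ge> 0; x = 0 \<or> b \<ge> t+1 \<and> x*(b+t) \<le> 1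
              \<and> x*((s+1)^2*(b-1) + (t+1)^2*(a+1)) \<le> (s+1)^2\<rbrakk>
            \<Longrightarrow> x*((b+t)*(b+t-1-(t*k-Q)) - 2*Q) \<le> CB"
  shows False
proof -
  obtain x y where x: "x \<ge> 0" "x = 0 \<or> a \<ge> s+1 \<and> x*(a+s) \<le> 1
              \<and> x*((t+1)^2*(a-1) + (s+1)^2*(b+1)) \<le> (t+1)^2"
    and y: "y \<ge> 0" "y = 0 \<or> b \<ge> t+1 \<and> y*(b+t) \<le> 1
              \<and> y*((s+1)^2*(b-1) + (t+1)^2*(a+1)) \<le> (s+1)^2"
    and xy: "(s+1)*a*(b-(t+1)) + (t+1)*b*(a-(s+1))
        \<le> (a+b) * ((t+1)*x*(a+s)*(a-(s+1)) + (s+1)*y*(b+t)*(b-(t+1)))"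
    using multipliers[OF s t a b] by blast
  define ph ps m' k' where "ph = s*m - P" and "ps = t*k - Q" and "m' = m - (a+s)" and "k' = k - (b+t)"
  have pos: "ph > 0" "ps > 0" "m' \<ge> 0" "k' \<ge> 0"
    using fA gB m k by (simp_all add: ph_def ps_def m'_def k'_def)
  have xp: "x*(a+s) \<le> 1" and yq: "y*(b+t) \<le> 1" using x y by auto
  have xs: "2*s*x \<le> 1"
  proof (cases "x = 0")
    case False
    then have "x*(2*s) \<le> x*(a+s)" using x by (intro mult_left_mono) auto
    with xp show ?thesis by (simp add: algebra_simps)
  qed simp
  have yt: "2*t*y \<le> 1"
  proof (cases "y = 0")
    case False
    then have "y*(2*t) \<le> y*(b+t)" using y by (intro mult_left_mono) auto
    with yq show ?thesis by (simp add: algebra_simps)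
  qed simp
  have CA': "(t+1)*((a+b)*(x*((a+s)*(a+s-1-(s*m-P)) - 2*P))) \<le> (t+1)*((a+b)*CA)"
    using CA[OF x] t a b by (intro mult_left_mono) auto
  have CB': "(s+1)*((a+b)*(y*((b+t)*(b+t-1-(t*k-Q)) - 2*Q))) \<le> (s+1)*((a+b)*CB)"
    using CB[OF y] s a b by (intro mult_left_mono) auto
  have e': "((t+1)*a + (s+1)*b)*((s+t+1)*(m+k+1)) \<le> ((t+1)*a + (s+1)*b)*(P+Q+(a+s)+(b+t)+e)"
    using e s t a b by (intro mult_left_mono) auto
  have A': "(t+1)*(a*(e - t*m + CA)) \<le> (t+1)*(b*(2*P - s*m + (a+s) - CA))"
    using sumA t by (intro mult_left_mono) auto
  have B': "(s+1)*(b*(e - s*k + CB)) \<le> (s+1)*(a*(2*Q - t*k + (b+t) - CB))"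
    using sumB s by (intro mult_left_mono) auto
  let ?R = "ph*((t+1)*a + 2*(t+1)*b + (s+1)*b - (t+1)*(a+b)*x*(a+s-2))
     + ps*((s+1)*b + 2*(s+1)*a + (t+1)*a - (s+1)*(a+b)*y*(b+t-2))
     + m'*(t+1)*(a+b)*(1-2*s*x) + k'*(s+1)*(a+b)*(1-2*t*y)"
  have identity: "(a+b) * ((t+1)*x*(a+s)*(a-(s+1)) + (s+1)*y*(b+t)*(b-(t+1))) + ?R
      - ((s+1)*a*(b-(t+1)) + (t+1)*b*(a-(s+1)))
    = (t+1)*((a+b)*(x*((a+s)*(a+s-1-(s*m-P)) - 2*P)))
      + (s+1)*((a+b)*(y*((b+t)*(b+t-1-(t*k-Q)) - 2*Q)))
      + ((t+1)*a + (s+1)*b)*((s+t+1)*(m+k+1))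
      - ((t+1)*a + (s+1)*b)*(P+Q+(a+s)+(b+t)+e)
      - (t+1)*((a+b)*CA) - (s+1)*((a+b)*CB)
      + (t+1)*(a*(e - t*m + CA)) - (t+1)*(b*(2*P - s*m + (a+s) - CA))
      + (s+1)*(b*(e - s*k + CB)) - (s+1)*(a*(2*Q - t*k + (b+t) - CB))"
    unfolding ph_def ps_def m'_def k'_def by (simp add: algebra_simps)
  have combine: "r \<le> 0" if "L + r - X = c1 + c2 + e1 - e2 - c3 - c4 + a1 - a2 + b1 - b2"
      "c1 \<le> c3" "c2 \<le> c4" "e1 \<le> e2" "a1 \<le> a2" "b1 \<le> b2" "X \<le> L"
    for L r X c1 c2 c3 c4 e1 e2 a1 a2 b1 b2 :: real
    using that by linarith
  have R: "?R \<le> 0" by (rule combine[OF identity CA' CB' e' A' B' xy])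
  have x2: "x*(a+s-2) \<le> 1" and y2: "y*(b+t-2) \<le> 1"
    using xp yq x(1) y(1) by (simp_all add: right_diff_distrib)
  have "(t+1)*(a+b)*(x*(a+s-2)) \<le> (t+1)*(a+b)*1"
    using x2 t a b by (intro mult_left_mono) auto
  moreover have "(s+1)*(a+b)*(y*(b+t-2)) \<le> (s+1)*(a+b)*1"
    using y2 s a b by (intro mult_left_mono) auto
  moreover have "(t+1)*b > 0" "(s+1)*b > 0" "(t+1)*a > 0" "(s+1)*a > 0" using s t a b by simp_all
  moreover have "(t+1)*a + 2*(t+1)*b + (s+1)*b - (t+1)*(a+b)*x*(a+s-2)
      = ((t+1)*(a+b)*1 - (t+1)*(a+b)*(x*(a+s-2))) + (t+1)*b + (s+1)*b"
    "(s+1)*b + 2*(s+1)*a + (t+1)*a - (s+1)*(a+b)*y*(b+t-2)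
      = ((s+1)*(a+b)*1 - (s+1)*(a+b)*(y*(b+t-2))) + (s+1)*a + (t+1)*a"
    by (simp_all add: algebra_simps)
  ultimately have "(t+1)*a + 2*(t+1)*b + (s+1)*b - (t+1)*(a+b)*x*(a+s-2) > 0"
     "(s+1)*b + 2*(s+1)*a + (t+1)*a - (s+1)*(a+b)*y*(b+t-2) > 0"
    by linarith+
  then have "ph*((t+1)*a + 2*(t+1)*b + (s+1)*b - (t+1)*(a+b)*x*(a+s-2)) > 0"
     "ps*((s+1)*b + 2*(s+1)*a + (t+1)*a - (s+1)*(a+b)*y*(b+t-2)) > 0"
    using pos by simp_all
  moreover have "m'*(t+1)*(a+b)*(1-2*s*x) \<ge> 0" "k'*(s+1)*(a+b)*(1-2*t*y) \<ge> 0"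
    using pos xs yt s t a b by simp_all
  ultimately show False using R by linarith
qed

text \<open>The weights \<open>t\<close> and \<open>s\<close> for \<open>sumA\<close> and \<open>sumB\<close> cancel the terms with \<open>m\<close> and \<open>k\<close> except for
  \<open>(t a + s b) (m+k+1)\<close>. What remains has bounded size since \<open>a\<close> and \<open>b\<close> are at most \<open>s\<close>
  and \<open>t\<close>, so it is too small for a large vertex set.\<close>

lemma decreasing_edge_contradiction:
  fixes s t a b m k P Q e CA CB :: real
  assumes s: "s > 0" and t: "t > 0" and a: "a > 0" "a \<le> s" and b: "b > 0" "b \<le> t"
    and fA: "P < s*m + a" and gB: "Q < t*k + b" and n: "s + t < m+k+1"
    and e: "(s+t+1)*(m+k+1) \<le> P+Q+(s-a)+(t-b)+e"
    and sumA: "a*(e - t*m + CA) \<le> b*(2*P - s*m + (s-a) - CA)"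
    and sumB: "b*(e - s*k + CB) \<le> a*(2*Q - t*k + (t-b) - CB)"
    and CA: "CA \<ge> 0" and CB: "CB \<ge> 0"
  shows False
proof -
  let ?N = "t*a + s*b"
  have "?N*((s+t+1)*(m+k+1)) \<le> ?N*(P+Q+(s-a)+(t-b)+e)"
    using e s t a b by (intro mult_left_mono) auto
  moreover have "t*(a*(e - t*m + CA)) \<le> t*(b*(2*P - s*m + (s-a) - CA))"
    using sumA t by (intro mult_left_mono) auto
  moreover have "s*(b*(e - s*k + CB)) \<le> s*(a*(2*Q - t*k + (t-b) - CB))"
    using sumB s by (intro mult_left_mono) auto
  moreover have "(?N+2*t*b)*P \<le> (?N+2*t*b)*(s*m+a)"
    using fA s t a b by (intro mult_left_mono) auto
  moreover have "(?N+2*s*a)*Q \<le> (?N+2*s*a)*(t*k+b)"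
    using gB s t a b by (intro mult_left_mono) auto
  moreover have "(t*a+t*b)*CA \<ge> 0" "(s*b+s*a)*CB \<ge> 0" using s t a b CA CB by simp_all
  moreover have "t*b*(s+a) + s*a*(t+b) - ?N*(m+k+1)
     = (?N*(P+Q+(s-a)+(t-b)+e) - ?N*((s+t+1)*(m+k+1)))
     + (t*(b*(2*P - s*m + (s-a) - CA)) - t*(a*(e - t*m + CA)))
     + (s*(a*(2*Q - t*k + (t-b) - CB)) - s*(b*(e - s*k + CB)))
     + ((?N+2*t*b)*(s*m+a) - (?N+2*t*b)*P) + ((?N+2*s*a)*(t*k+b) - (?N+2*s*a)*Q)
     + (t*a+t*b)*CA + (s*b+s*a)*CB"
    by algebra
  ultimately have "?N*(m+k+1) \<le> t*b*(s+a) + s*a*(t+b)" by linarith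
  moreover have "?N*(s+t) < ?N*(m+k+1)"
    using n s t a b by (intro mult_strict_left_mono) (auto simp: add_pos_pos)
  moreover have "t*a*(t-b) \<ge> 0" "s*b*(s-a) \<ge> 0" using s t a b by simp_all
  moreover have "?N*(s+t) - (t*b*(s+a) + s*a*(t+b)) = t*a*(t-b) + s*b*(s-a)" by algebra
  ultimately show False by linarith
qed

section \<open>The contradiction\<close>

lemma (in top_edge) impossible: False
proof -
  define m k P Q where "m = real (card A)" and "k = real (card B)"
    and "P = real (num_edges E A)" and "Q = real (num_edges E B)"
  define e where "e = (\<Sum>z\<in>A. deg B z)"
  have eB: "e = (\<Sum>z\<in>B. deg A z)" unfolding e_def by (rule sum_deg_swap)
  have fin: "finite A" "finite B" by (rule parts)+
  have p: "deg A v = \<alpha> + s" and q: "deg B v = \<beta> + t" by (simp_all add: \<alpha>_def \<beta>_def)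
  have sA: "surplus s A = P - s*m" and sB: "surplus t B = Q - t*k"
    by (simp_all add: surplus_def P_def Q_def m_def k_def)
  have "real (card (insert v (A \<union> B))) = m + k + 1"
    unfolding m_def k_def using parts(2-) by (simp add: card_Un_disjoint)
  then have cardV: "real (card V) = m + k + 1"
    unfolding parts(1)[symmetric] .
  have "real (num_edges E (insert v (A \<union> B))) = P + Q + (\<alpha>+s) + (\<beta>+t) + e"
    unfolding P_def Q_def e_def p[symmetric] q[symmetric] using parts(2-)
    by (simp add: num_edges_insert num_edges_union deg_union)
  then have "real (num_edges E V) = P + Q + (\<alpha>+s) + (\<beta>+t) + e"
    unfolding parts(1)[symmetric] .
  then have dense': "(s+t+1) * (m+k+1) \<le> P + Q + (\<alpha>+s) + (\<beta>+t) + e"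
    using dense unfolding cardV by simp
  have "\<forall>z\<in>A. \<exists>r. 0 \<le> r \<and> r \<le> 1 \<and>
      \<bar>\<alpha>\<bar> * (deg B z - t + (1 - r) * adj v z) \<le> \<bar>\<beta>\<bar> * (deg A z - s + r * adj v z) \<and>
      (\<alpha> > 0 \<longrightarrow> adj v z = 1 \<longrightarrow> surplus s A + \<alpha> - deg A z + s - 1 \<ge> 0 \<longrightarrow>
       r = 0 \<or> (t+1)^2 * (surplus s A + \<alpha> - deg A z + s - 1)
          \<le> (1 - r) * ((t+1)^2 * (\<alpha>-1) + (s+1)^2 * (\<beta>+1)))"
    by (rule ballI, erule remove_from_A) blast
  from bchoice[OF this] obtain a where a: "\<And>z. z \<in> A \<Longrightarrow> 0 \<le> a z \<and> a z \<le> 1 \<and>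
      \<bar>\<alpha>\<bar> * (deg B z - t + (1 - a z) * adj v z) \<le> \<bar>\<beta>\<bar> * (deg A z - s + a z * adj v z) \<and>
      (\<alpha> > 0 \<longrightarrow> adj v z = 1 \<longrightarrow> surplus s A + \<alpha> - deg A z + s - 1 \<ge> 0 \<longrightarrow>
       a z = 0 \<or> (t+1)^2 * (surplus s A + \<alpha> - deg A z + s - 1)
          \<le> (1 - a z) * ((t+1)^2 * (\<alpha>-1) + (s+1)^2 * (\<beta>+1)))"
    by blast
  have "\<forall>z\<in>B. \<exists>r. 0 \<le> r \<and> r \<le> 1 \<and>
      \<bar>\<beta>\<bar> * (deg A z - s + r * adj v z) \<le> \<bar>\<alpha>\<bar> * (deg B z - t + (1 - r) * adj v z) \<and>
      (\<alpha> > 0 \<longrightarrow> adj v z = 1 \<longrightarrow> surplus t B + \<beta> - deg B z + t - 1 \<ge> 0 \<longrightarrow>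
       r = 1 \<or> (s+1)^2 * (surplus t B + \<beta> - deg B z + t - 1)
          \<le> r * ((s+1)^2 * (\<beta>-1) + (t+1)^2 * (\<alpha>+1)))"
    by (rule ballI, erule remove_from_B) blast
  from bchoice[OF this] obtain b where b: "\<And>z. z \<in> B \<Longrightarrow> 0 \<le> b z \<and> b z \<le> 1 \<and>
      \<bar>\<beta>\<bar> * (deg A z - s + b z * adj v z) \<le> \<bar>\<alpha>\<bar> * (deg B z - t + (1 - b z) * adj v z) \<and>
      (\<alpha> > 0 \<longrightarrow> adj v z = 1 \<longrightarrow> surplus t B + \<beta> - deg B z + t - 1 \<ge> 0 \<longrightarrow>
       b z = 1 \<or> (s+1)^2 * (surplus t B + \<beta> - deg B z + t - 1)
          \<le> b z * ((s+1)^2 * (\<beta>-1) + (t+1)^2 * (\<alpha>+1)))"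
    by blast
  define CA where "CA = (\<Sum>z\<in>A. (1 - a z) * adj v z)"
  (* 1 - b z in the place of a z, for the use of exchange_sum and neighbour_sum *)
  define CB where "CB = (\<Sum>z\<in>B. (1 - (1 - b z)) * adj v z)"
  have "\<bar>\<alpha>\<bar> * (e - t*m + CA) \<le> \<bar>\<beta>\<bar> * (2*P - s*m + deg A v - CA)"
    unfolding e_def P_def m_def CA_def
    by (rule exchange_sum[OF fin(1)]) (use a in blast)
  then have sumA: "\<bar>\<alpha>\<bar> * (e - t*m + CA) \<le> \<bar>\<beta>\<bar> * (2*P - s*m + (\<alpha>+s) - CA)"
    unfolding p .
  have "\<bar>\<beta>\<bar> * (e - s*k + CB) \<le> \<bar>\<alpha>\<bar> * (2*Q - t*k + deg B v - CB)"
    unfolding eB Q_def k_def CB_def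
    by (rule exchange_sum[OF fin(2)]) (use b in simp)
  then have sumB: "\<bar>\<beta>\<bar> * (e - s*k + CB) \<le> \<bar>\<alpha>\<bar> * (2*Q - t*k + (\<beta>+t) - CB)"
    unfolding q .
  from shape show False
  proof
    assume up: "\<alpha> > 0 \<and> \<beta> > 0 \<and> surplus s A < 0 \<and> surplus t B < 0
        \<and> balance A < 0 \<and> balance (insert v A) > 0"
    then have pos: "\<alpha> > 0" "\<beta> > 0" by auto
    have "\<alpha> + s \<le> m" "\<beta> + t \<le> k"
      unfolding p[symmetric] q[symmetric] m_def k_def using fin by (auto intro: deg_le_card)
    moreover have "P < s*m" "Q < t*k" using up sA sB by auto
    moreover have "x*((\<alpha>+s)*(\<alpha>+s-1-(s*m-P)) - 2*P) \<le> CA"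
      if x: "x \<ge> 0" "x = 0 \<or> \<alpha> \<ge> s+1 \<and> x*(\<alpha>+s) \<le> 1
              \<and> x*((t+1)^2*(\<alpha>-1) + (s+1)^2*(\<beta>+1)) \<le> (t+1)^2" for x
    proof (cases "x = 0")
      case True
      have "CA \<ge> 0" unfolding CA_def using a by (intro sum_nonneg mult_nonneg_nonneg) auto
      with True show ?thesis by simp
    next
      case False
      with x have x': "\<alpha> \<ge> s+1" "x*deg A v \<le> 1"
          "x*((t+1)^2*(\<alpha>-1) + (s+1)^2*(\<beta>+1)) \<le> (t+1)^2" by (auto simp: p)
      have N: "(t+1)^2*(\<alpha>-1) + (s+1)^2*(\<beta>+1) > 0"
        using x'(1) pos s t by (intro add_pos_pos mult_pos_pos) auto
      have "x * (deg A v * (deg A v - 1 - (s*m-P)) - 2 * real (num_edges E A)) \<le> CA"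
        unfolding CA_def
      proof (rule neighbour_sum[OF fin(1) _ x(1) x'(2,3) N])
        fix z assume z: "z \<in> A" "adj v z = 1" "deg A v - 1 - (s*m-P) - deg A z \<ge> 0"
        have eq: "surplus s A + \<alpha> - deg A z + s - 1 = deg A v - 1 - (s*m-P) - deg A z"
          using sA p by simp
        show "a z = 0 \<or> (t+1)^2 * (deg A v - 1 - (s*m-P) - deg A z)
            \<le> (1 - a z) * ((t+1)^2*(\<alpha>-1) + (s+1)^2*(\<beta>+1))"
          using a[OF z(1)] pos(1) z(2,3) unfolding eq by blast
      qed (use a up sA in auto)
      then show ?thesis unfolding p P_def by (simp add: add_diff_eq)
    qed
    moreover have "x*((\<beta>+t)*(\<beta>+t-1-(t*k-Q)) - 2*Q) \<le> CB"
      if x: "x \<ge> 0" "x = 0 \<or> \<beta> \<ge> t+1 \<and> x*(\<beta>+t) \<le> 1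
              \<and> x*((s+1)^2*(\<beta>-1) + (t+1)^2*(\<alpha>+1)) \<le> (s+1)^2" for x
    proof (cases "x = 0")
      case True
      have "CB \<ge> 0" unfolding CB_def using b by (intro sum_nonneg mult_nonneg_nonneg) auto
      with True show ?thesis by simp
    next
      case False
      with x have x': "\<beta> \<ge> t+1" "x*deg B v \<le> 1"
          "x*((s+1)^2*(\<beta>-1) + (t+1)^2*(\<alpha>+1)) \<le> (s+1)^2" by (auto simp: q)
      have N: "(s+1)^2*(\<beta>-1) + (t+1)^2*(\<alpha>+1) > 0"
        using x'(1) pos s t by (intro add_pos_pos mult_pos_pos) auto
      have "x * (deg B v * (deg B v - 1 - (t*k-Q)) - 2 * real (num_edges E B)) \<le> CB"
        unfolding CB_def
      proof (rule neighbour_sum[OF fin(2) _ x(1) x'(2,3) N])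
        fix z assume z: "z \<in> B" "adj v z = 1" "deg B v - 1 - (t*k-Q) - deg B z \<ge> 0"
        have eq: "surplus t B + \<beta> - deg B z + t - 1 = deg B v - 1 - (t*k-Q) - deg B z"
          using sB q by simp
        have "b z = 1 \<or> (s+1)^2 * (deg B v - 1 - (t*k-Q) - deg B z)
            \<le> b z * ((s+1)^2*(\<beta>-1) + (t+1)^2*(\<alpha>+1))"
          using b[OF z(1)] pos(1) z(2,3) unfolding eq by blast
        then show "1 - b z = 0 \<or> (s+1)^2 * (deg B v - 1 - (t*k-Q) - deg B z)
            \<le> (1 - (1 - b z)) * ((s+1)^2*(\<beta>-1) + (t+1)^2*(\<alpha>+1))" by auto
      qed (use b up sB in auto)
      then show ?thesis unfolding q Q_def by (simp add: add_diff_eq)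
    qed
    ultimately show False
      using increasing_edge_contradiction[OF s t pos, of P m Q k e CA CB] dense' sumA sumB pos by simp
  next
    assume down: "\<alpha> < 0 \<and> \<beta> < 0
        \<and> surplus s (insert v A) < 0 \<and> surplus t (V - A) < 0
        \<and> balance A > 0 \<and> balance (insert v A) < 0"
    have "-\<alpha> \<le> s" "-\<beta> \<le> t" using p q deg_nonneg[of A v] deg_nonneg[of B v] by linarith+
    moreover have "P < s*m + (-\<alpha>)" "Q < t*k + (-\<beta>)" using down unfolding edge sA sB by auto
    moreover have "CA \<ge> 0" unfolding CA_def using a by (intro sum_nonneg mult_nonneg_nonneg) auto
    moreover have "CB \<ge> 0" unfolding CB_def using b by (intro sum_nonneg mult_nonneg_nonneg) auto
    ultimately show False
      using decreasing_edge_contradiction[OF s t, of "-\<alpha>" "-\<beta>" P m Q k e CA CB]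
        down large cardV dense' sumA sumB by (simp add: add.commute)
  qed
qed

lemma (in unsplittable) absurd: False
proof -
  obtain A v \<tau> where "crossing A v \<tau>" "level A v \<tau> > 0"
      "\<forall>X w \<sigma>. crossing X w \<sigma> \<longrightarrow> level X w \<sigma> \<le> level A v \<tau>"
    using ex_top_crossing by blast
  then interpret top_edge V E s t A v \<tau>
    by unfold_locales auto
  show False by (rule impossible)
qed

theorem theorem1:
  fixes V :: "'a set" and E :: "'a set set" and s t :: real
  assumes "finite_simple_graph V E"
    and "V \<noteq> {}"
    and "s > 0" and "t > 0"
    and "real (num_edges E V) \<ge> (s + t + 1) * real (card V)"
  shows "\<exists>A B. A \<union> B = V \<and> A \<inter> B = {} \<and> A \<noteq> {} \<and> B \<noteq> {} \<and>
           real (num_edges E A) - s * real (card A) \<ge> 0 \<and>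
           real (num_edges E B) - t * real (card B) \<ge> 0"
proof (rule ccontr)
  assume none: "\<not> ?thesis"
  interpret finite_simple_graph V E by (rule assms(1))
  have "surplus s A < 0 \<or> surplus t (V - A) < 0" if "A \<subseteq> V" "A \<noteq> {}" "A \<noteq> V" for A
  proof (rule ccontr)
    assume "\<not> ?thesis"
    then have "A \<union> (V - A) = V \<and> A \<inter> (V - A) = {} \<and> A \<noteq> {} \<and> V - A \<noteq> {} \<and>
           real (num_edges E A) - s * real (card A) \<ge> 0 \<and>
           real (num_edges E (V - A)) - t * real (card (V - A)) \<ge> 0"
      using that by (auto simp: surplus_def)
    with none show False by blast
  qed
  then interpret unsplittable V E s t
    using assms by unfold_locales auto
  show False by (rule absurd)
qed

end
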